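(* For every integer $\ell\ge 2$ there is a constant $C_\ell>0$, depending only on $\ell$, such that for every integer $t\ge 1$ there is $n_0=n_0(\ell,t)$ such that for all $n\ge n_0$, $$\mathrm{ex}(n,\Theta_{\ell,t})\le C_\ell\, t^{1-1/\ell}\, n^{1+1/\ell}.$$
   Context: All graphs are finite and simple. $\mathrm{ex}(n,F)$ is the maximum number of edges in an $n$-vertex graph containing no subgraph (not necessarily induced) isomorphic to $F$. The theta graph $\Theta_{\ell,t}$ consists of two distinct vertices joined by $t$ internally vertex-disjoint paths, each of length $\ell$ (that is, with $\ell$ edges). *)

theory Defs
  imports Complex_Main
begin

text \<open>A graph is a pair of a vertex set and a set of edges, an edge being the two-element set of
  its endpoints.\<close>

type_synonym 'a graph = "'a set \<times> 'a set set"

abbreviation verts :: "'a graph \<Rightarrow> 'a set" where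
  "verts G \<equiv> fst G"

abbreviation edges :: "'a graph \<Rightarrow> 'a set set" where
  "edges G \<equiv> snd G"

definition simple_graph :: "'a graph \<Rightarrow> bool" where
  "simple_graph G \<longleftrightarrow> finite (verts G) \<and> (\<forall>e\<in>edges G. e \<subseteq> verts G \<and> card e = 2)"

text \<open>The subgraph is not required to be induced.\<close>

definition contains_copy :: "'a graph \<Rightarrow> 'b graph \<Rightarrow> bool" where
  "contains_copy G F \<longleftrightarrow>
    (\<exists>f. inj_on f (verts F) \<and> f ` verts F \<subseteq> verts G \<and> (\<forall>e\<in>edges F. f ` e \<in> edges G))"

text \<open>Host graphs live on natural numbers, which loses nothing: every finite graph is isomorphic
  to such a graph. The set of edge numbers is finite, being bounded by \<open>n choose 2\<close>; it is nonempty
  as soon as \<open>F\<close> has an edge, because the edgeless graph on \<open>n\<close> vertices then contains no copy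
  of \<open>F\<close>.\<close>

definition ex :: "nat \<Rightarrow> 'b graph \<Rightarrow> nat" where
  "ex n F = Max {card (edges G) | G :: nat graph.
     simple_graph G \<and> card (verts G) = n \<and> \<not> contains_copy G F}"

datatype theta_vertex = Source | Sink | Inner nat nat

text \<open>The vertex in position \<open>j \<le> l\<close> on the \<open>i\<close>-th path from \<open>Source\<close> to \<open>Sink\<close>.\<close>

definition theta_pos :: "nat \<Rightarrow> nat \<Rightarrow> nat \<Rightarrow> theta_vertex" where
  "theta_pos l i j = (if j = 0 then Source else if j = l then Sink else Inner i j)"

definition theta_graph :: "nat \<Rightarrow> nat \<Rightarrow> theta_vertex graph" where
  "theta_graph l t =
    ({Source, Sink} \<union> {theta_pos l i j | i j. i < t \<and> j \<le> l},
     {{theta_pos l i j, theta_pos l i (Suc j)} | i j. i < t \<and> j < l})"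

end

theory Submission
  imports Defs "HOL-Library.Sublist"
begin

text \<open>
  Suppose the host graph is almost regular of degree about \<open>d\<close>, where \<open>d ^ l\<close> is a large multiple
  of \<open>t ^ (l - 1) * n\<close>, and put \<open>Q = 3 * l\<^sup>2 * t\<close>. Call a pair of vertices \<^emph>\<open>rich\<close> at \<open>k\<close> if it is joined
  by more than \<open>Q ^ (k - 2)\<close> paths on \<open>k\<close> vertices none of whose proper subpaths joins a rich pair.
  Fixing one inner vertex of such a path leaves at most \<open>Q ^ (k - 3)\<close> choices, so any \<open>Q / k\<close>
  vertices can be avoided by some path of this kind. Hence a pair rich at \<open>l + 1\<close> spans a theta graph.
  Otherwise at least half of the paths of length \<open>l\<close> contain a minimal rich subpath,
  and for some \<open>3 \<le> k \<le> l\<close> and some vertex \<open>x\<close> there are about \<open>d ^ (k - 1)\<close> minimal rich paths on \<open>k\<close>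
  vertices starting in \<open>x\<close>. Their last edges form a relation whose average degree on both sides is
  at least \<open>Q\<close>. Walking in a subrelation of large minimum degree, one reaches from
  a suitable vertex \<open>p\<close>, in \<open>l + 1 - k\<close> steps and avoiding any few prescribed vertices, a vertex that
  forms a rich pair with \<open>x\<close>; completing these walks by rich paths gives the theta graph with poles
  \<open>p\<close> and \<open>x\<close>.
\<close>

section \<open>Rich pairs and good paths\<close>

lemma card_UN_le_mult:
  assumes "finite I" "\<And>i. i \<in> I \<Longrightarrow> card (A i) \<le> c"
  shows "card (\<Union>i\<in>I. A i) \<le> card I * c"
proof -
  have "card (\<Union>i\<in>I. A i) \<le> (\<Sum>i\<in>I. card (A i))"
    by (rule card_UN_le[OF assms(1)])
  also have "\<dots> \<le> card I * c"
    using sum_bounded_above[of I "\<lambda>i. card (A i)" c] assms(2) by simp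
  finally show ?thesis .
qed

definition inner :: "'a list \<Rightarrow> 'a set" where
  "inner p = set (butlast (tl p))"

lemma in_inner_conv_nth: "w \<in> inner p \<longleftrightarrow> (\<exists>j. 0 < j \<and> Suc j < length p \<and> p ! j = w)"
proof
  assume "w \<in> inner p"
  then obtain i where "i < length (butlast (tl p))" "butlast (tl p) ! i = w"
    by (auto simp: inner_def in_set_conv_nth)
  then show "\<exists>j. 0 < j \<and> Suc j < length p \<and> p ! j = w"
    by (intro exI[of _ "Suc i"]) (auto simp: nth_butlast nth_tl)
next
  assume "\<exists>j. 0 < j \<and> Suc j < length p \<and> p ! j = w"
  then obtain j where "0 < j" "Suc j < length p" "p ! j = w" by blast
  then show "w \<in> inner p"
    unfolding inner_def in_set_conv_nth
    by (intro exI[of _ "j - 1"]) (auto simp: nth_butlast nth_tl)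
qed

lemma finite_inner [simp]: "finite (inner p)"
  by (simp add: inner_def)

lemma card_inner_le: "card (inner p) \<le> length p - 2"
  unfolding inner_def by (rule order_trans[OF card_length]) simp

locale graph_rel =
  fixes V :: "'a set" and E :: "'a \<Rightarrow> 'a \<Rightarrow> bool"
  assumes finite_V: "finite V"
    and E_sym: "E u v \<Longrightarrow> E v u"
    and E_in_V: "E u v \<Longrightarrow> u \<in> V"
    and irrefl: "\<not> E u u"
begin

text \<open>Throughout, \<open>k\<close> counts the vertices of a path, while \<open>l\<close> counts its edges.\<close>

definition paths :: "nat \<Rightarrow> 'a list set" where
  "paths k = {p. length p = k \<and> distinct p \<and> successively E p \<and> set p \<subseteq> V}"

lemma finite_paths [simp]: "finite (paths k)"
  by (rule finite_subset[OF _ finite_lists_length_eq[OF finite_V, of k]]) (auto simp: paths_def)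

lemma finite_nbrs [simp]: "finite {v. E u v}"
  by (rule finite_subset[OF _ finite_V]) (auto dest: E_sym E_in_V)

lemma paths_sublist: "p \<in> paths k \<Longrightarrow> sublist q p \<Longrightarrow> q \<in> paths (length q)"
  by (auto simp: paths_def sublist_def successively_append_iff)

lemma paths_rev: "p \<in> paths k \<Longrightarrow> rev p \<in> paths k"
  by (auto simp: paths_def elim!: successively_mono dest: E_sym)

definition clean :: "(nat \<times> 'a \<times> 'a) set \<Rightarrow> 'a list \<Rightarrow> bool" where
  "clean R p \<longleftrightarrow> (\<forall>q. q \<noteq> [] \<longrightarrow> sublist q p \<longrightarrow> (length q, hd q, last q) \<notin> R)"

text \<open>\<open>rich Q k\<close> collects the rich pairs \<open>(j, x, y)\<close> with \<open>j < k\<close>, so that a path on \<open>k\<close> vertices is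
  clean for \<open>rich Q k\<close> iff none of its proper subpaths joins a rich pair.\<close>

primrec rich :: "nat \<Rightarrow> nat \<Rightarrow> (nat \<times> 'a \<times> 'a) set" where
  "rich Q 0 = {}"
| "rich Q (Suc k) = rich Q k \<union>
    {(j, x, y). j = k \<and> Q ^ (k - 2) < card {p \<in> paths k. hd p = x \<and> last p = y \<and> clean (rich Q k) p}}"

declare rich.simps(2) [simp del]

definition good :: "nat \<Rightarrow> nat \<Rightarrow> 'a \<Rightarrow> 'a \<Rightarrow> 'a list set" where
  "good Q k x y = {p \<in> paths k. hd p = x \<and> last p = y \<and> clean (rich Q k) p}"

lemma finite_good [simp]: "finite (good Q k x y)"
  by (simp add: good_def)

text \<open>Whether a pair is rich at \<open>j\<close> is settled by paths on \<open>j\<close>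
  vertices alone; \<open>k\<close> only truncates. Hence the stages of the recursion are nested, and
  a path that is clean at one level is clean at every lower one.\<close>

lemma rich_iff: "(j, x, y) \<in> rich Q k \<longleftrightarrow> j < k \<and> Q ^ (j - 2) < card (good Q j x y)"
  by (induction k) (auto simp: rich.simps(2) good_def less_Suc_eq)

lemma rich_mono: "j \<le> k \<Longrightarrow> rich Q j \<subseteq> rich Q k"
  by (auto simp: rich_iff)

lemma clean_sublist: "clean R p \<Longrightarrow> sublist q p \<Longrightarrow> clean R q"
  unfolding clean_def by (meson sublist_order.order.trans)

lemma good_sublist:
  assumes "p \<in> good Q k x y" "sublist q p"
  shows "q \<in> good Q (length q) (hd q) (last q)"
proof -
  have "length q \<le> k"
    using assms by (auto simp: good_def paths_def dest: sublist_length_le)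
  then show ?thesis
    using assms clean_sublist[OF _ assms(2), of "rich Q k"] rich_mono[of "length q" k Q] paths_sublist[OF _ assms(2)]
    unfolding good_def clean_def by blast
qed

text \<open>Cleanness becomes an upper bound here: the ends of a proper subpath of a good path are
  not rich, so few good paths of that length join them.\<close>

lemma card_good_sublist:
  assumes "p \<in> good Q k x y" "sublist q p" "q \<noteq> []" "length q < k"
  shows "card (good Q (length q) (hd q) (last q)) \<le> Q ^ (length q - 2)"
  using assms rich_iff[of "length q" "hd q" "last q" Q k] by (auto simp: good_def clean_def not_less)

text \<open>A path on at most two vertices is determined by its ends, and with truncated subtraction
  the threshold \<open>Q ^ (k - 2)\<close> is then 1. So rich pairs occur only from
  \<open>k = 3\<close> on.\<close>

lemma card_good_small:
  assumes "k \<le> 2"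
  shows "card (good Q k x y) \<le> 1"
proof -
  have "p = (if k = 0 then [] else if k = 1 then [x] else [x, y])" if "p \<in> good Q k x y" for p
    using that assms by (cases p; cases "tl p") (auto simp: good_def paths_def)
  then have "good Q k x y \<subseteq> {if k = 0 then [] else if k = 1 then [x] else [x, y]}"
    by blast
  from card_mono[OF _ this] show ?thesis by simp
qed

text \<open>Cutting a path at position \<open>j\<close> is injective and gives two proper good
  subpaths with fixed ends, on \<open>j + 1\<close> and \<open>k - j\<close> vertices. Neither pair
  of ends is rich, and the two bounds multiply to \<open>Q ^ ((j - 1) + (k - j - 2))\<close>, a
  factor \<open>Q\<close> below the threshold for \<open>k\<close>.\<close>

lemma card_good_nth_le:
  assumes "0 < j" "Suc j < k"
  shows "card {p \<in> good Q k x y. p ! j = w} \<le> Q ^ (k - 3)"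
proof (cases "{p \<in> good Q k x y. p ! j = w} = {}")
  case False
  let ?A = "{p \<in> good Q k x y. p ! j = w}"
  let ?f = "\<lambda>p. (take (Suc j) p, drop j p)"
  have *: "take (Suc j) p \<in> good Q (Suc j) x w \<and> drop j p \<in> good Q (k - j) w y \<and>
      card (good Q (Suc j) x w) \<le> Q ^ (Suc j - 2) \<and> card (good Q (k - j) w y) \<le> Q ^ (k - j - 2)"
    if "p \<in> ?A" for p
  proof -
    from that have p: "p \<in> good Q k x y" "p ! j = w" "length p = k" "hd p = x" "last p = y" "p \<noteq> []"
      using assms by (auto simp: good_def paths_def)
    have eqs: "hd (take (Suc j) p) = x" "last (take (Suc j) p) = w" "hd (drop j p) = w" "last (drop j p) = y"
      "length (take (Suc j) p) = Suc j" "length (drop j p) = k - j"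
      using p assms by (auto simp: hd_drop_conv_nth take_Suc_conv_app_nth)
    have s: "sublist (take (Suc j) p) p" "sublist (drop j p) p"
      by auto
    show ?thesis
      using good_sublist[OF p(1) s(1)] good_sublist[OF p(1) s(2)]
        card_good_sublist[OF p(1) s(1)] card_good_sublist[OF p(1) s(2)] assms p(3,6)
      unfolding eqs by auto
  qed
  have "inj_on ?f ?A"
  proof (rule inj_onI)
    fix p q assume pq: "p \<in> ?A" "q \<in> ?A" "?f p = ?f q"
    have "take j p = take j q"
      using pq(3) by (metis (no_types, lifting) Pair_inject min.absorb1 le_SucI order_refl take_take)
    then show "p = q" using pq(3) by (metis Pair_inject append_take_drop_id)
  qed
  moreover have "?f ` ?A \<subseteq> good Q (Suc j) x w \<times> good Q (k - j) w y"
    using * by blast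
  ultimately have "card ?A \<le> card (good Q (Suc j) x w) * card (good Q (k - j) w y)"
    using card_inj_on_le[of ?f ?A "good Q (Suc j) x w \<times> good Q (k - j) w y"]
    by (simp add: card_cartesian_product)
  also have "\<dots> \<le> Q ^ (Suc j - 2) * Q ^ (k - j - 2)"
    using False * by (intro mult_le_mono) auto
  also have "\<dots> = Q ^ (k - 3)"
    using assms by (simp flip: power_add)
  finally show ?thesis .
qed (simp only: card.empty)

text \<open>If \<open>W\<close> met the interior of every good path, these paths would fall into at
  most \<open>(k - 2) * card W\<close> classes, one for each inner position and vertex of
  \<open>W\<close>. Each class has at most \<open>Q ^ (k - 3)\<close> members, which is too few for
  a rich pair.\<close>

lemma good_avoiding:
  assumes "Q ^ (k - 2) < card (good Q k x y)" "finite W" "card W * k \<le> Q"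
  shows "\<exists>p\<in>good Q k x y. inner p \<inter> W = {}"
proof (rule ccontr)
  assume neg: "\<not> ?thesis"
  have k: "3 \<le> k"
  proof (rule ccontr)
    assume "\<not> 3 \<le> k"
    then show False using card_good_small[of k Q x y] assms(1) by simp
  qed
  have "good Q k x y \<subseteq> (\<Union>(j, w)\<in>{1..<k-1} \<times> W. {p \<in> good Q k x y. p ! j = w})"
  proof
    fix p assume p: "p \<in> good Q k x y"
    then obtain w where w: "w \<in> inner p" "w \<in> W" using neg by blast
    then obtain j where "0 < j" "Suc j < length p" "p ! j = w"
      by (auto simp: in_inner_conv_nth)
    then show "p \<in> (\<Union>(j, w)\<in>{1..<k-1} \<times> W. {p \<in> good Q k x y. p ! j = w})"
      using p w by (auto simp: good_def paths_def)
  qed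
  then have "card (good Q k x y) \<le> card (\<Union>(j, w)\<in>{1..<k-1} \<times> W. {p \<in> good Q k x y. p ! j = w})"
    using assms(2) by (intro card_mono) auto
  also have "\<dots> \<le> card ({1..<k-1} \<times> W) * Q ^ (k - 3)"
    using assms(2) card_good_nth_le by (intro card_UN_le_mult) auto
  also have "\<dots> \<le> Q * Q ^ (k - 3)"
  proof (rule mult_right_mono)
    have "card ({1..<k-1} \<times> W) = (k - 1 - 1) * card W" by (simp add: card_cartesian_product)
    also have "\<dots> \<le> k * card W" by simp
    also have "\<dots> \<le> Q" using assms(3) by (simp add: mult.commute)
    finally show "card ({1..<k-1} \<times> W) \<le> Q" .
  qed simp
  also have "\<dots> = Q ^ (k - 2)"
    using k by (metis Suc_diff_Suc Suc_le_lessD eval_nat_numeral(3) power_Suc)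
  finally show False using assms(1) by simp
qed

section \<open>Robust pairs and internally disjoint paths\<close>

definition robust :: "nat \<Rightarrow> nat \<Rightarrow> 'a \<Rightarrow> 'a \<Rightarrow> bool" where
  "robust l s x y \<longleftrightarrow> (\<forall>W. finite W \<longrightarrow> card W \<le> s \<longrightarrow>
     (\<exists>p\<in>paths (Suc l). hd p = x \<and> last p = y \<and> inner p \<inter> W = {}))"

text \<open>Greedy choice: fewer than \<open>t\<close> earlier paths have at most
  \<open>l * t\<close> inner vertices together, so robustness yields one more path that avoids all
  of them.\<close>

lemma robust_disjoint_paths:
  assumes "robust l (l * t) x y" "r \<le> t"
  shows "\<exists>P. (\<forall>i<r. P i \<in> paths (Suc l) \<and> hd (P i) = x \<and> last (P i) = y) \<and>
           (\<forall>i<r. \<forall>j<r. i \<noteq> j \<longrightarrow> inner (P i) \<inter> inner (P j) = {})"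
  using assms(2)
proof (induction r)
  case (Suc r)
  then obtain P where P: "\<forall>i<r. P i \<in> paths (Suc l) \<and> hd (P i) = x \<and> last (P i) = y"
    "\<forall>i<r. \<forall>j<r. i \<noteq> j \<longrightarrow> inner (P i) \<inter> inner (P j) = {}" by auto
  let ?W = "\<Union>i\<in>{..<r}. inner (P i)"
  have "card ?W \<le> card {..<r} * l"
  proof (rule card_UN_le_mult)
    fix i assume "i \<in> {..<r}"
    then have "length (P i) = Suc l" using P(1) by (auto simp: paths_def)
    then show "card (inner (P i)) \<le> l" using card_inner_le[of "P i"] by simp
  qed simp
  also have "\<dots> \<le> l * t" using Suc.prems by simp
  finally obtain p where p: "p \<in> paths (Suc l)" "hd p = x" "last p = y" "inner p \<inter> ?W = {}"
    using assms(1) unfolding robust_def by (metis finite_UN finite_inner finite_lessThan)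
  show ?case
    by (rule exI[of _ "P(r := p)"]) (use P p in \<open>auto simp: less_Suc_eq disjoint_iff\<close>)
qed auto

section \<open>Counting paths and walks\<close>

text \<open>Paths grow at the head: a path on at most \<open>l\<close> vertices blocks at most
  \<open>l\<close> of the \<open>d + l\<close> neighbours of its head.\<close>

lemma card_paths_ge:
  assumes "\<And>v. v \<in> V \<Longrightarrow> d + l \<le> card {u. E v u}" "k \<le> l"
  shows "card V * d ^ k \<le> card (paths (Suc k))"
  using assms(2)
proof (induction k)
  case 0
  have "inj_on (\<lambda>x. [x]) V" "(\<lambda>x. [x]) ` V \<subseteq> paths (Suc 0)"
    by (auto simp: paths_def inj_on_def)
  from card_inj_on_le[OF this] show ?case by simp
next
  case (Suc k)
  let ?N = "\<lambda>p. {u. E (hd p) u} - set p"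
  let ?D = "Sigma (paths (Suc k)) ?N"
  have fin: "finite ?D" by (intro finite_SigmaI) auto
  have "d \<le> card (?N p)" if "p \<in> paths (Suc k)" for p
  proof -
    have "hd p \<in> V" using that by (cases p) (auto simp: paths_def)
    then have "d + l \<le> card {u. E (hd p) u}" by (rule assms(1))
    moreover have "card (set p) \<le> l"
      using that Suc.prems card_length[of p] by (auto simp: paths_def)
    ultimately show ?thesis
      using diff_card_le_card_Diff[of "set p" "{u. E (hd p) u}"] by simp
  qed
  then have "card (paths (Suc k)) * d \<le> (\<Sum>p\<in>paths (Suc k). card (?N p))"
    using sum_bounded_below[of "paths (Suc k)" d "\<lambda>p. card (?N p)"] by simp
  also have "\<dots> = card ?D" by simp
  also have "\<dots> \<le> card (paths (Suc (Suc k)))"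
  proof (rule card_inj_on_le)
    show "inj_on (\<lambda>(p, x). x # p) ?D" by (auto simp: inj_on_def)
    show "(\<lambda>(p, x). x # p) ` ?D \<subseteq> paths (Suc (Suc k))"
      by (auto simp: paths_def successively_Cons dest: E_sym intro: E_in_V[OF E_sym])
  qed simp
  finally have "card (paths (Suc k)) * d \<le> card (paths (Suc (Suc k)))" .
  moreover have "card V * d ^ Suc k \<le> card (paths (Suc k)) * d"
    using Suc by simp
  ultimately show ?case by linarith
qed

text \<open>Each new vertex has at most \<open>D\<close> choices. Added vertices may repeat, which
  is harmless for an upper bound. Finiteness is part of the induction because
  \<open>card_mono\<close> needs it at each step.\<close>

lemma extend_left:
  assumes "finite S" "\<And>p. p \<in> S \<Longrightarrow> length p = Suc k" "\<And>v. card {u. E v u} \<le> D"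
  shows "finite {p. length p = a + Suc k \<and> successively E p \<and> drop a p \<in> S} \<and>
    card {p. length p = a + Suc k \<and> successively E p \<and> drop a p \<in> S} \<le> card S * D ^ a"
proof (induction a)
  case 0
  have "{p. length p = 0 + Suc k \<and> successively E p \<and> drop 0 p \<in> S} \<subseteq> S" by auto
  with assms(1) show ?case by (auto intro: finite_subset card_mono)
next
  case (Suc a)
  let ?T = "\<lambda>a. {p. length p = a + Suc k \<and> successively E p \<and> drop a p \<in> S}"
  have sub: "?T (Suc a) \<subseteq> (\<Union>p\<in>?T a. (\<lambda>u. u # p) ` {u. E (hd p) u})"
  proof
    fix p assume "p \<in> ?T (Suc a)"
    then show "p \<in> (\<Union>p\<in>?T a. (\<lambda>u. u # p) ` {u. E (hd p) u})"
      by (cases p) (auto simp: successively_Cons intro: E_sym)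
  qed
  have fin: "finite (\<Union>p\<in>?T a. (\<lambda>u. u # p) ` {u. E (hd p) u})"
    using Suc by auto
  have "card (?T (Suc a)) \<le> card (\<Union>p\<in>?T a. (\<lambda>u. u # p) ` {u. E (hd p) u})"
    by (rule card_mono[OF fin sub])
  also have "\<dots> \<le> card (?T a) * D"
    using Suc assms(3) by (intro card_UN_le_mult) (auto intro: order_trans[OF card_image_le])
  also have "\<dots> \<le> card S * D ^ Suc a"
    using Suc by simp
  finally show ?case using finite_subset[OF sub fin] by simp
qed

lemma extend_right:
  assumes "finite S" "\<And>p. p \<in> S \<Longrightarrow> length p = Suc k" "\<And>v. card {u. E v u} \<le> D"
  shows "finite {p. length p = Suc k + b \<and> successively E p \<and> take (Suc k) p \<in> S} \<and>
    card {p. length p = Suc k + b \<and> successively E p \<and> take (Suc k) p \<in> S} \<le> card S * D ^ b"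
proof -
  let ?A = "{p. length p = Suc k + b \<and> successively E p \<and> take (Suc k) p \<in> S}"
  let ?B = "{p. length p = b + Suc k \<and> successively E p \<and> drop b p \<in> rev ` S}"
  have B: "finite ?B \<and> card ?B \<le> card (rev ` S) * D ^ b"
    by (rule extend_left) (use assms in auto)
  have sub: "rev ` ?A \<subseteq> ?B"
    by (auto simp: drop_rev elim!: successively_mono dest: E_sym)
  have "finite ?A"
    using finite_subset[OF sub] B by (simp add: finite_image_iff)
  moreover have "card ?A \<le> card ?B"
    using B sub by (intro card_inj_on_le[of rev]) auto
  moreover have "card (rev ` S) = card S"
    by (simp add: card_image)
  ultimately show ?thesis using B by simp
qed

text \<open>The bound for walks that carry a member of \<open>S\<close> at the fixed position
  \<open>a\<close>; it will count the paths that contain a minimal rich subpath there.\<close>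

lemma extend_both:
  assumes "finite S" "\<And>p. p \<in> S \<Longrightarrow> length p = Suc k" "\<And>v. card {u. E v u} \<le> D"
  shows "finite {p. length p = a + (Suc k + b) \<and> successively E p \<and> take (Suc k) (drop a p) \<in> S} \<and>
    card {p. length p = a + (Suc k + b) \<and> successively E p \<and> take (Suc k) (drop a p) \<in> S}
      \<le> card S * D ^ (a + b)"
proof -
  let ?S = "{p. length p = Suc k + b \<and> successively E p \<and> take (Suc k) p \<in> S}"
  let ?A = "{p. length p = a + (Suc k + b) \<and> successively E p \<and> take (Suc k) (drop a p) \<in> S}"
  let ?B = "{p. length p = a + Suc (k + b) \<and> successively E p \<and> drop a p \<in> ?S}"
  have S: "finite ?S \<and> card ?S \<le> card S * D ^ b"
    by (rule extend_right[OF assms])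
  have B: "finite ?B \<and> card ?B \<le> card ?S * D ^ a"
    by (rule extend_left) (use assms S in auto)
  have "?A \<subseteq> ?B"
    by (auto simp: sublist_def) (metis append_take_drop_id successively_append_iff)
  then have "finite ?A" "card ?A \<le> card ?B"
    using B by (auto intro: finite_subset card_mono)
  moreover have "card ?S * D ^ a \<le> card S * D ^ (a + b)"
    using S mult_le_mono1[of "card ?S" "card S * D ^ b" "D ^ a"] by (simp add: power_add mult_ac)
  ultimately show ?thesis using B by linarith
qed

end

section \<open>Subrelations of large minimum degree\<close>

text \<open>For a bipartite graph: delete vertices of degree below \<open>Q / 2\<close> one at a
  time. A deletion lowers the left side of the density hypothesis by at least \<open>Q\<close> and
  the right side by less than \<open>Q\<close>, so the hypothesis survives.\<close>

lemma min_degree_subrelation: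
  fixes R :: "('a \<times> 'b) set"
  assumes "finite R" "R \<noteq> {}" "Q * (card (Domain R) + card (Range R)) \<le> 2 * card R"
  shows "\<exists>R'\<subseteq>R. R' \<noteq> {} \<and> (\<forall>y\<in>Domain R'. Q \<le> 2 * card (R' `` {y})) \<and>
           (\<forall>z\<in>Range R'. Q \<le> 2 * card (R'\<inverse> `` {z}))"
  using assms
proof (induction "card R" arbitrary: R rule: less_induct)
  case less
  define deg_ok where "deg_ok \<longleftrightarrow> (\<forall>y\<in>Domain R. Q \<le> 2 * card (R `` {y})) \<and>
           (\<forall>z\<in>Range R. Q \<le> 2 * card (R\<inverse> `` {z}))"
  show ?case
  proof (cases deg_ok)
    case True
    then show ?thesis using less.prems unfolding deg_ok_def by blast
  next
    case False
    \<comment> \<open>\<open>S\<close> is the set of edges at the deleted vertex.\<close>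
    have step: ?thesis if S: "S \<subseteq> R" "S \<noteq> {}" "2 * card S < Q"
      "card (Domain (R - S)) + card (Range (R - S)) < card (Domain R) + card (Range R)" for S
    proof -
      have fin: "finite S" using S less.prems finite_subset by blast
      have card: "card (R - S) + card S = card R"
        using S less.prems card_mono[of R S] fin by (simp add: card_Diff_subset)
      have "card S > 0" using S fin by (simp add: card_gt_0_iff)
      have "Q * (card (Domain (R - S)) + card (Range (R - S))) + Q
          = Q * (Suc (card (Domain (R - S)) + card (Range (R - S))))" by simp
      also have "\<dots> \<le> Q * (card (Domain R) + card (Range R))"
        using S(4) by (intro mult_le_mono2) simp
      also have "\<dots> \<le> 2 * card R" by (rule less.prems)
      finally have *: "Q * (card (Domain (R - S)) + card (Range (R - S))) + Q \<le> 2 * card R" .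
      \<comment> \<open>Otherwise \<open>card R = card S\<close>, and \<open>*\<close> would give
        \<open>Q \<le> 2 * card S\<close>.\<close>
      have "R - S \<noteq> {}"
      proof
        assume "R - S = {}"
        then have "card R = card S" using card by (metis add_0 card.empty)
        then show False using * S(3) by linarith
      qed
      moreover have "card (R - S) < card R" using card \<open>card S > 0\<close> by linarith
      moreover have "Q * (card (Domain (R - S)) + card (Range (R - S))) \<le> 2 * card (R - S)"
        using * S(3) card by linarith
      ultimately have "\<exists>R'\<subseteq>R - S. R' \<noteq> {} \<and> (\<forall>y\<in>Domain R'. Q \<le> 2 * card (R' `` {y})) \<and>
           (\<forall>z\<in>Range R'. Q \<le> 2 * card (R'\<inverse> `` {z}))"
        using less.prems by (intro less.hyps) auto
      then obtain R' where "R' \<subseteq> R - S" and R': "R' \<noteq> {}"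
        "\<forall>y\<in>Domain R'. Q \<le> 2 * card (R' `` {y})" "\<forall>z\<in>Range R'. Q \<le> 2 * card (R'\<inverse> `` {z})"
        by (elim exE conjE)
      then have "R' \<subseteq> R" by blast
      with R' show ?thesis by (intro exI[of _ R'] conjI)
    qed
    have finDR: "finite (Domain R)" "finite (Range R)"
      using less.prems by (auto simp: finite_Domain finite_Range)
    from False consider y where "y \<in> Domain R" "2 * card (R `` {y}) < Q"
      | z where "z \<in> Range R" "2 * card (R\<inverse> `` {z}) < Q"
      unfolding deg_ok_def by (auto simp: not_le)
    then show ?thesis
    proof cases
      case 1
      let ?S = "{y} \<times> (R `` {y})"
      have "Domain (R - ?S) \<subset> Domain R" using 1 by auto
      then have "card (Domain (R - ?S)) < card (Domain R)" using finDR by (simp add: psubset_card_mono)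
      moreover have "card (Range (R - ?S)) \<le> card (Range R)" using finDR by (intro card_mono) auto
      ultimately show ?thesis using 1 by (intro step[of ?S]) (auto simp: card_cartesian_product)
    next
      case 2
      let ?S = "(R\<inverse> `` {z}) \<times> {z}"
      have "Range (R - ?S) \<subset> Range R" using 2 by auto
      then have "card (Range (R - ?S)) < card (Range R)" using finDR by (simp add: psubset_card_mono)
      moreover have "card (Domain (R - ?S)) \<le> card (Domain R)" using finDR by (intro card_mono) auto
      ultimately show ?thesis using 2 by (intro step[of ?S]) (auto simp: card_cartesian_product)
    qed
  qed
qed

section \<open>Counting minimal rich paths\<close>

context graph_rel
begin

definition rich_paths :: "nat \<Rightarrow> nat \<Rightarrow> 'a list set" where
  "rich_paths Q k = {q \<in> paths k. q \<in> good Q k (hd q) (last q) \<and>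
     Q ^ (k - 2) < card (good Q k (hd q) (last q))}"

lemma finite_rich_paths [simp]: "finite (rich_paths Q k)"
  by (simp add: rich_paths_def)

text \<open>Take a shortest subpath joining a rich pair; minimality makes it clean at its own level,
  hence good. Its position \<open>a\<close> is recorded for the count by
  \<open>extend_both\<close>.\<close>

lemma not_clean_imp_rich_subpath:
  assumes "p \<in> paths (Suc l)" "\<not> clean (rich Q (Suc l)) p"
  shows "\<exists>k a. 3 \<le> k \<and> k \<le> l \<and> a + k \<le> Suc l \<and> take k (drop a p) \<in> rich_paths Q k"
proof -
  let ?P = "\<lambda>q. q \<noteq> [] \<and> sublist q p \<and> (length q, hd q, last q) \<in> rich Q (Suc l)"
  obtain q0 where "?P q0"
    using assms(2) unfolding clean_def by blast
  then obtain q where q: "?P q" and min: "\<And>q'. ?P q' \<Longrightarrow> length q \<le> length q'"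
    using ex_has_least_nat[of ?P q0 length] by blast
  let ?k = "length q"
  from q have k: "?k \<le> l" "Q ^ (?k - 2) < card (good Q ?k (hd q) (last q))"
    by (auto simp: rich_iff)
  have "3 \<le> ?k"
  proof (rule ccontr)
    assume "\<not> 3 \<le> ?k"
    then show False using card_good_small[of ?k Q "hd q" "last q"] k(2) by simp
  qed
  have "clean (rich Q ?k) q"
    unfolding clean_def
  proof (intro allI impI notI)
    fix q' assume q': "q' \<noteq> []" "sublist q' q" "(length q', hd q', last q') \<in> rich Q ?k"
    have "?P q'"
      using q' q k rich_mono[of ?k "Suc l" Q] by (auto intro: sublist_order.order.trans)
    then have "?k \<le> length q'" by (rule min)
    then show False using q'(3) by (simp add: rich_iff)
  qed
  moreover have "q \<in> paths ?k" using paths_sublist[OF assms(1)] q by blast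
  ultimately have "q \<in> rich_paths Q ?k"
    using k by (simp add: rich_paths_def good_def)
  moreover obtain ps ss where "p = ps @ q @ ss" using q by (auto simp: sublist_def)
  ultimately show ?thesis
    using \<open>3 \<le> ?k\<close> k assms(1)
    by (intro exI[of _ ?k] exI[of _ "length ps"]) (auto simp: paths_def)
qed

text \<open>Suppose not, and let \<open>X = card V * d ^ l\<close>, a lower bound for the number of
  paths with \<open>l\<close> edges. Good ones number at most \<open>X / 2\<close> by
  \<open>few\<close> and \<open>large\<close>. Every other path contains a minimal rich subpath of
  some length \<open>k\<close> at some position \<open>a\<close>. Each pair \<open>(k, a)\<close>
  accounts for at most \<open>X / (2 * l ^ 2)\<close> paths, and there are fewer than
  \<open>l ^ 2\<close> pairs, so the total falls short of \<open>X\<close>.\<close>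

lemma many_rich_paths:
  assumes V: "V \<noteq> {}"
    and deg_ge: "\<And>v. v \<in> V \<Longrightarrow> d + l \<le> card {u. E v u}"
    and deg_le: "\<And>v. card {u. E v u} \<le> K * d"
    and d: "0 < d" and l: "2 \<le> l"
    and few: "\<And>x y. card (good Q (Suc l) x y) \<le> Q ^ (l - 1)"
    and large: "2 * card V * Q ^ (l - 1) \<le> d ^ l"
  shows "\<exists>k x. 3 \<le> k \<and> k \<le> l \<and> x \<in> V \<and>
    d ^ l < 2 * l ^ 2 * card {q \<in> rich_paths Q k. hd q = x} * (K * d) ^ (Suc l - k)"
proof (rule ccontr)
  assume "\<not> ?thesis"
  then have le: "2 * l ^ 2 * card {q \<in> rich_paths Q k. hd q = x} * (K * d) ^ (Suc l - k) \<le> d ^ l"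
    if "3 \<le> k" "k \<le> l" "x \<in> V" for k x
    using that by (meson not_less)
  let ?X = "card V * d ^ l"
  have X0: "0 < ?X" using V d finite_V by (simp add: card_gt_0_iff)
  have leX: "2 * l ^ 2 * (card (rich_paths Q k) * (K * d) ^ (Suc l - k)) \<le> ?X"
    if k: "3 \<le> k" "k \<le> l" for k
  proof -
    have "rich_paths Q k \<subseteq> (\<Union>x\<in>V. {q \<in> rich_paths Q k. hd q = x})"
    proof
      fix q assume q: "q \<in> rich_paths Q k"
      then have "hd q \<in> V" using k by (cases q) (auto simp: rich_paths_def paths_def)
      with q show "q \<in> (\<Union>x\<in>V. {q \<in> rich_paths Q k. hd q = x})" by blast
    qed
    then have "card (rich_paths Q k) \<le> (\<Sum>x\<in>V. card {q \<in> rich_paths Q k. hd q = x})"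
      using finite_V by (intro order_trans[OF card_mono card_UN_le]) auto
    then have "2 * l ^ 2 * (card (rich_paths Q k) * (K * d) ^ (Suc l - k))
        \<le> 2 * l ^ 2 * ((\<Sum>x\<in>V. card {q \<in> rich_paths Q k. hd q = x}) * (K * d) ^ (Suc l - k))"
      by (intro mult_le_mono2 mult_le_mono1)
    also have "\<dots> = (\<Sum>x\<in>V. 2 * l ^ 2 * card {q \<in> rich_paths Q k. hd q = x} * (K * d) ^ (Suc l - k))"
      by (simp add: sum_distrib_left sum_distrib_right mult.assoc)
    also have "\<dots> \<le> (\<Sum>x\<in>V. d ^ l)"
      using le[OF k] by (rule sum_mono)
    finally show ?thesis by simp
  qed
  \<comment> \<open>Walks on \<open>l + 1\<close> vertices with a minimal rich path on
    \<open>k\<close> vertices at position \<open>a\<close>; the lengths are written in the shape of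
    \<open>extend_both\<close>.\<close>
  define T where "T = (\<lambda>k a. {p. length p = a + (Suc (k - 1) + (Suc l - k - a)) \<and> successively E p \<and>
      take (Suc (k - 1)) (drop a p) \<in> rich_paths Q k})"
  \<comment> \<open>Since \<open>k\<close> is at least 3, a position satisfies
    \<open>a \<le> l + 1 - k \<le> l - 2\<close>.\<close>
  let ?I = "{3..l} \<times> {0..<l-1}"
  let ?J = "{(k, a) \<in> ?I. a + k \<le> Suc l}"
  have finT: "finite (T k a)"
    and cardT: "2 * l ^ 2 * card (T k a) \<le> ?X" if ka: "(k, a) \<in> ?J" for k a
  proof -
    have *: "finite (T k a) \<and> card (T k a) \<le> card (rich_paths Q k) * (K * d) ^ (a + (Suc l - k - a))"
      unfolding T_def
    proof (rule extend_both)
      show "length p = Suc (k - 1)" if "p \<in> rich_paths Q k" for p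
        using that ka by (auto simp: rich_paths_def paths_def)
    qed (use deg_le in auto)
    then show "finite (T k a)" by blast
    have "a + (Suc l - k - a) = Suc l - k" using ka by auto
    then have "card (T k a) \<le> card (rich_paths Q k) * (K * d) ^ (Suc l - k)" using * by simp
    then show "2 * l ^ 2 * card (T k a) \<le> ?X"
      by (rule order_trans[OF mult_le_mono2 leX]) (use ka in auto)
  qed
  let ?G = "\<Union>(x, y)\<in>V \<times> V. good Q (Suc l) x y"
  let ?B = "\<Union>(k, a)\<in>?J. T k a"
  have finJ: "finite ?J" by (rule finite_subset[of _ ?I]) auto
  have "paths (Suc l) \<subseteq> ?G \<union> ?B"
  proof
    fix p assume p: "p \<in> paths (Suc l)"
    show "p \<in> ?G \<union> ?B"
    proof (cases "clean (rich Q (Suc l)) p")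
      case True
      have "p \<noteq> []" "set p \<subseteq> V" using p by (auto simp: paths_def)
      then have "hd p \<in> V" "last p \<in> V" by auto
      then show ?thesis using True p by (auto simp: good_def)
    next
      case False
      then obtain k a where ka: "3 \<le> k" "k \<le> l" "a + k \<le> Suc l" "take k (drop a p) \<in> rich_paths Q k"
        using not_clean_imp_rich_subpath[OF p] by blast
      then have "p \<in> T k a" "(k, a) \<in> ?J" using p by (auto simp: T_def paths_def)
      then show ?thesis by blast
    qed
  qed
  moreover have "finite ?G" using finite_V by auto
  moreover have "finite ?B"
    by (rule finite_UN_I[OF finJ]) (use finT in \<open>auto split: prod.split\<close>)
  ultimately have "card (paths (Suc l)) \<le> card (?G \<union> ?B)" by (intro card_mono) auto
  also have "\<dots> \<le> card ?G + card ?B" by (rule card_Un_le)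
  finally have "?X \<le> card ?G + card ?B"
    using card_paths_ge[of d l l, OF deg_ge] by simp
  moreover have "2 * card ?G \<le> ?X"
  proof -
    have "card ?G \<le> card (V \<times> V) * Q ^ (l - 1)"
      using finite_V few by (intro card_UN_le_mult) auto
    then have "2 * card ?G \<le> card V * (2 * card V * Q ^ (l - 1))"
      by (simp add: card_cartesian_product)
    also have "\<dots> \<le> ?X" using large by (intro mult_le_mono2)
    finally show ?thesis .
  qed
  moreover have "2 * l ^ 2 * card ?B < l ^ 2 * ?X"
  proof -
    have "card ?B \<le> (\<Sum>i\<in>?J. card (case i of (k, a) \<Rightarrow> T k a))"
      by (rule card_UN_le[OF finJ])
    then have "2 * l ^ 2 * card ?B \<le> (\<Sum>i\<in>?J. 2 * l ^ 2 * card (case i of (k, a) \<Rightarrow> T k a))"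
      by (simp add: sum_distrib_left[symmetric])
    also have "\<dots> \<le> (\<Sum>i\<in>?J. ?X)"
      using cardT by (intro sum_mono) (auto split: prod.split)
    also have "\<dots> \<le> card ?I * ?X"
    proof -
      have "card ?J \<le> card ?I" by (rule card_mono) auto
      then show ?thesis by (simp only: sum_constant of_nat_id mult_le_mono1)
    qed
    also have "\<dots> = (l - 2) * (l - 1) * ?X" by (simp add: card_cartesian_product)
    also have "\<dots> < l ^ 2 * ?X"
    proof -
      have "(l - 2) * (l - 1) \<le> (l - 2) * l" by simp
      also have "\<dots> < l * l" using l by (intro mult_less_mono1) auto
      finally show ?thesis using X0 by (simp add: power2_eq_square)
    qed
    finally show ?thesis .
  qed
  ultimately have 1: "?X \<le> card ?G + card ?B" "2 * card ?G \<le> ?X" "2 * l ^ 2 * card ?B < l ^ 2 * ?X" .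
  have "l ^ 2 * (?X + ?X) \<le> l ^ 2 * (?X + 2 * card ?B)"
    using 1(1,2) by (intro mult_le_mono2) linarith
  then have "l ^ 2 * ?X + l ^ 2 * ?X \<le> l ^ 2 * ?X + 2 * l ^ 2 * card ?B"
    by (simp only: distrib_left mult_ac)
  with 1(3) show False by linarith
qed

section \<open>From minimal rich paths to a robust pair\<close>

text \<open>Greedy walk down the layers. Each visited vertex joins the forbidden set while one step
  fewer remains, so \<open>card W + b \<le> D\<close> persists. The starting vertex itself may lie
  in \<open>W\<close>.\<close>

lemma alternating_path_avoiding:
  assumes "\<And>b u. u \<in> F (Suc b) \<Longrightarrow> D \<le> card {v \<in> F b. E u v}"
    and "\<And>b. F b \<subseteq> V"
    and "u \<in> F b" "finite W" "card W + b \<le> D"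
  shows "\<exists>q\<in>paths (Suc b). hd q = u \<and> last q \<in> F 0 \<and> set q \<subseteq> (\<Union>i. F i) \<and> set (tl q) \<inter> W = {}"
  using assms(3-5)
proof (induction b arbitrary: u W)
  case 0
  then show ?case using assms(2) by (intro bexI[of _ "[u]"]) (auto simp: paths_def)
next
  case (Suc b)
  let ?N = "{v \<in> F b. E u v}"
  have "card (insert u W) \<le> Suc (card W)" by (rule card_insert_le_m1) auto
  then have card: "card (insert u W) + b \<le> D" using Suc.prems by simp
  have "finite (F b)" using assms(2) finite_V finite_subset by blast
  have u: "u \<in> V" using Suc.prems assms(2) by blast
  have "\<not> ?N \<subseteq> insert u W"
  proof
    assume sub: "?N \<subseteq> insert u W"
    show False
    proof (cases "u \<in> ?N")
      case False
      then have "?N \<subseteq> W" using sub by blast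
      then have "card ?N \<le> card W" using Suc.prems by (intro card_mono)
      then show False using assms(1)[OF Suc.prems(1)] Suc.prems(3) by linarith
    qed (use irrefl in auto)
  qed
  then obtain v where v: "v \<in> F b" "E u v" "v \<notin> insert u W" by blast
  obtain q where q: "q \<in> paths (Suc b)" "hd q = v" "last q \<in> F 0" "set q \<subseteq> (\<Union>i. F i)"
    "set (tl q) \<inter> insert u W = {}"
    using Suc.IH[OF v(1) _ card] Suc.prems by auto
  have "q \<noteq> []" using q by (auto simp: paths_def)
  then have "set q = insert v (set (tl q))" using q(2) by (metis list.collapse list.simps(15))
  then show ?case
    using q v u Suc.prems \<open>q \<noteq> []\<close>
    by (intro bexI[of _ "u # q"]) (auto simp: paths_def successively_Cons)
qed

end

lemma card_eq_sum_fibres: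
  "finite S \<Longrightarrow> card S = (\<Sum>z\<in>g ` S. card {q \<in> S. g q = z})"
  using sum.image_gen[of S "\<lambda>_. 1 :: nat" g] by simp

lemma last_butlast:
  assumes "2 \<le> length q"
  shows "last (butlast q) = q ! (length q - 2)"
proof -
  have "butlast q \<noteq> []"
    using assms by (cases q; cases "tl q") auto
  then show ?thesis
    using assms by (simp add: last_conv_nth nth_butlast numeral_2_eq_2)
qed

context graph_rel
begin

text \<open>Walks in \<open>R\<close> alternate between \<open>Domain R\<close> and \<open>Range R\<close>; the pole \<open>p\<close> is taken on the side from
  which \<open>l + 1 - k\<close> steps end in \<open>Range R\<close>, hence in \<open>Z\<close>.\<close>

lemma robust_spider:
  assumes k: "3 \<le> k" "k \<le> l" and t: "1 \<le> t" and Q: "3 * l ^ 2 * t \<le> Q"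
    and rich: "\<And>z. z \<in> Z \<Longrightarrow> Q ^ (k - 2) < card (good Q k x z)"
    and R: "R \<noteq> {}" "\<And>y z. (y, z) \<in> R \<Longrightarrow> E y z \<and> y \<noteq> x \<and> z \<noteq> x \<and> z \<in> Z"
    and degs: "\<And>y. y \<in> Domain R \<Longrightarrow> Q \<le> 2 * card (R `` {y})"
      "\<And>z. z \<in> Range R \<Longrightarrow> Q \<le> 2 * card (R\<inverse> `` {z})"
  shows "\<exists>p. robust l (l * t) p x"
proof -
  define F where "F b = (if even b then Range R else Domain R)" for b :: nat
  \<comment> \<open>\<open>b\<close> steps followed by the \<open>k - 1\<close> edges of a rich path
    make \<open>l\<close> edges in all.\<close>
  define b where "b = Suc l - k"
  have F_V: "F i \<subseteq> V" for i
    using R(2) by (auto simp: F_def intro: E_in_V E_sym)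
  \<comment> \<open>Room for avoiding \<open>l * t\<close> prescribed vertices and at most
    \<open>l\<close> vertices of the walk itself.\<close>
  have F_deg: "l * t + l \<le> card {v \<in> F i. E u v}" if "u \<in> F (Suc i)" for i u
  proof -
    have "2 * (l * t + l) \<le> 4 * (l * t)" using t by simp
    also have "\<dots> \<le> 2 * (l * (l * t))"
      using k by (simp add: mult_le_mono)
    also have "\<dots> \<le> Q" using Q by (simp add: power2_eq_square)
    finally have "2 * (l * t + l) \<le> Q" .
    moreover have "\<exists>A. A \<subseteq> {v \<in> F i. E u v} \<and> Q \<le> 2 * card A"
    proof (cases "even i")
      case True
      then have "R `` {u} \<subseteq> {v \<in> F i. E u v}" "Q \<le> 2 * card (R `` {u})"
        using that R(2) by (auto simp: F_def intro: degs)
      then show ?thesis by blast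
    next
      case False
      then have "R\<inverse> `` {u} \<subseteq> {v \<in> F i. E u v}" "Q \<le> 2 * card (R\<inverse> `` {u})"
        using that R(2) by (auto simp: F_def intro: degs E_sym)
      then show ?thesis by blast
    qed
    ultimately obtain A where A: "A \<subseteq> {v \<in> F i. E u v}" "2 * (l * t + l) \<le> 2 * card A"
      by (meson le_trans)
    have "finite {v \<in> F i. E u v}" by (rule finite_subset[OF _ finite_nbrs[of u]]) auto
    then have "card A \<le> card {v \<in> F i. E u v}" using A(1) by (rule card_mono)
    moreover from A(2) have "l * t + l \<le> card A" by simp
    ultimately show ?thesis by (rule le_trans[rotated])
  qed
  from R(1) obtain y z where "(y, z) \<in> R" by auto
  then have "(if even b then z else y) \<in> F b" by (auto simp: F_def)
  then obtain p where p: "p \<in> F b" by blast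
  have "robust l (l * t) p x"
    unfolding robust_def
  proof (intro allI impI)
    fix W :: "'a set" assume W: "finite W" "card W \<le> l * t"
    have "card W + b \<le> l * t + l" using W k by (simp add: b_def)
    from alternating_path_avoiding[of F, OF F_deg F_V p W(1) this]
    obtain q where q: "q \<in> paths (Suc b)" "hd q = p" "last q \<in> F 0" "set q \<subseteq> (\<Union>i. F i)"
      "set (tl q) \<inter> W = {}" by blast
    define z where "z = last q"
    have "z \<in> Z" using q(3) R(2) by (auto simp: F_def z_def)
    have "x \<notin> F i" for i using R(2) by (auto simp: F_def)
    then have "x \<notin> set q" using q(4) by blast
    \<comment> \<open>The rich path from \<open>x\<close> to \<open>z\<close> must avoid both
      \<open>W\<close> and the walk \<open>q\<close> in its interior; the factor
      \<open>l ^ 2\<close> in \<open>Q\<close> pays for this.\<close>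
    have "card (W \<union> set q) * k \<le> Q"
    proof -
      have "card (set q) \<le> l" using q(1) k card_length[of q] by (simp add: paths_def b_def)
      then have "card (W \<union> set q) \<le> l * t + l" using W card_Un_le[of W "set q"] by linarith
      then have "card (W \<union> set q) * k \<le> (l * t + l) * l" using k by (intro mult_le_mono)
      also have "\<dots> \<le> (2 * (l * t)) * l" using t by (intro mult_le_mono1) simp
      also have "\<dots> \<le> Q" using Q by (simp add: power2_eq_square mult_ac)
      finally show ?thesis .
    qed
    then obtain r where r: "r \<in> good Q k x z" "inner r \<inter> (W \<union> set q) = {}"
      using good_avoiding[OF rich[OF \<open>z \<in> Z\<close>], of "W \<union> set q"] W(1) by auto
    have "length r = k" "hd r = x" "last r = z" using r(1) by (auto simp: good_def paths_def)
    then obtain m where m: "r = x # m @ [z]"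
      using k by (cases r; cases "tl r" rule: rev_cases) auto
    obtain q1 where q1: "q = q1 @ [z]"
      using q(1) z_def by (cases q rule: rev_cases) (auto simp: paths_def)
    obtain q2 where q2: "q = p # q2"
      using q(1,2) by (cases q) (auto simp: paths_def)
    have "rev r \<in> paths k" using r(1) by (auto simp: good_def intro: paths_rev)
    then have succ: "successively E (z # rev m @ [x])" and props: "distinct (x # m @ [z])" "set r \<subseteq> V"
      using m by (auto simp: paths_def)
    have "inner r = set m" by (simp add: m inner_def)
    \<comment> \<open>The walk from \<open>p\<close> to \<open>z\<close>, continued by the reversed
      rich path to \<open>x\<close>. It is a path because \<open>R\<close> avoids \<open>x\<close>
      and the interior of \<open>r\<close> avoids \<open>q\<close>.\<close>
    let ?P = "q @ rev m @ [x]"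
    have "successively E ?P"
      using succ q(1) by (auto simp: q1 paths_def successively_append_iff successively_Cons)
    moreover have "distinct ?P"
      using q(1) props r(2) \<open>inner r = set m\<close> \<open>x \<notin> set q\<close> by (auto simp: paths_def)
    moreover have "length ?P = Suc l"
      using q(1) \<open>length r = k\<close> k by (auto simp: paths_def m b_def)
    moreover have "set ?P \<subseteq> V"
      using q(1) props m by (auto simp: paths_def)
    moreover have "inner ?P = set q2 \<union> set m"
      by (simp add: q2 inner_def butlast_append)
    moreover have "set q2 \<inter> W = {}" using q(5) q2 by simp
    ultimately show "\<exists>P\<in>paths (Suc l). hd P = p \<and> last P = x \<and> inner P \<inter> W = {}"
      using r(2) \<open>inner r = set m\<close> q2
      by (intro bexI[of _ ?P]) (auto simp: paths_def)
  qed
  then show ?thesis by blast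
qed

text \<open>If no pair is rich at \<open>l + 1\<close>, fix \<open>x\<close> and \<open>k\<close>
  with many minimal rich paths from \<open>x\<close> and call their set \<open>S\<close>. Counting
  \<open>S\<close> by last edges, last vertices and penultimate vertices shows that the relation
  \<open>R\<close> of last edges has average degree at least \<open>Q\<close> on both sides, as
  \<open>robust_spider\<close> requires after \<open>min_degree_subrelation\<close>.\<close>

lemma exists_robust:
  assumes V: "V \<noteq> {}"
    and deg_ge: "\<And>v. v \<in> V \<Longrightarrow> d + l \<le> card {u. E v u}"
    and deg_le: "\<And>v. card {u. E v u} \<le> K * d"
    and l: "2 \<le> l" and t: "1 \<le> t" and K: "1 \<le> K"
    and Q: "Q = 3 * l ^ 2 * t"
    and large: "2 * card V * Q ^ (l - 1) \<le> d ^ l" "2 * l ^ 2 * K ^ l * Q ^ l \<le> d"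
  shows "\<exists>x y. robust l (l * t) x y"
proof (rule ccontr)
  assume neg: "\<not> ?thesis"
  have Q0: "1 \<le> Q" using l t by (simp add: Q)
  have d0: "1 \<le> d"
    using large(2) l K Q0 by (metis One_nat_def Suc_leI gr0I le_0_eq mult_eq_0_iff not_numeral_le_zero power_not_zero not_one_le_zero zero_neq_numeral)
  have few: "card (good Q (Suc l) x y) \<le> Q ^ (l - 1)" for x y
  proof (rule ccontr)
    assume "\<not> ?thesis"
    then have *: "Q ^ (Suc l - 2) < card (good Q (Suc l) x y)"
      using l by (simp add: numeral_2_eq_2)
    have "robust l (l * t) x y"
      unfolding robust_def
    proof (intro allI impI)
      fix W :: "'a set" assume W: "finite W" "card W \<le> l * t"
      have "card W * Suc l \<le> (l * t) * (2 * l)" using W l by (intro mult_le_mono) auto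
      also have "\<dots> \<le> Q" by (simp add: Q power2_eq_square mult_ac)
      finally show "\<exists>p\<in>paths (Suc l). hd p = x \<and> last p = y \<and> inner p \<inter> W = {}"
        using good_avoiding[OF * W(1)] by (auto simp: good_def)
    qed
    with neg show False by blast
  qed
  obtain k x where kx: "3 \<le> k" "k \<le> l" "x \<in> V"
    "d ^ l < 2 * l ^ 2 * card {q \<in> rich_paths Q k. hd q = x} * (K * d) ^ (Suc l - k)"
    using many_rich_paths[OF V deg_ge deg_le _ l few large(1)] d0 by auto
  define S where "S = {q \<in> rich_paths Q k. hd q = x}"
  have S_good: "q \<in> good Q k x (last q)" "Q ^ (k - 2) < card (good Q k x (last q))"
    "length q = k" "distinct q" "hd q = x" "successively E q" if "q \<in> S" for q
    using that by (auto simp: S_def rich_paths_def good_def paths_def)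
  have finS: "finite S" by (simp add: S_def)
  \<comment> \<open>Otherwise the lower bound for \<open>S\<close> would involve only
    \<open>d ^ (l - 1)\<close> times constants, and the second part of \<open>large\<close> makes
    \<open>d\<close> exceed those constants.\<close>
  have S_large: "Q ^ (k - 2) * (K * d) ^ (k - 2) \<le> card S"
  proof (rule ccontr)
    assume "\<not> ?thesis"
    then have "card S \<le> Q ^ (k - 2) * (K * d) ^ (k - 2)" by simp
    then have "2 * l ^ 2 * card S * (K * d) ^ (Suc l - k)
      \<le> 2 * l ^ 2 * (Q ^ (k - 2) * (K * d) ^ (k - 2)) * (K * d) ^ (Suc l - k)"
      by (intro mult_le_mono1 mult_le_mono2)
    also have "\<dots> = 2 * l ^ 2 * Q ^ (k - 2) * (K * d) ^ ((k - 2) + (Suc l - k))"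
      by (simp only: power_add mult_ac)
    also have "(k - 2) + (Suc l - k) = l - 1" using kx by simp
    also have "2 * l ^ 2 * Q ^ (k - 2) * (K * d) ^ (l - 1) = 2 * l ^ 2 * K ^ (l - 1) * Q ^ (k - 2) * d ^ (l - 1)"
      by (simp only: power_mult_distrib mult_ac)
    also have "\<dots> \<le> 2 * l ^ 2 * K ^ l * Q ^ l * d ^ (l - 1)"
      using K Q0 kx by (intro mult_le_mono order_refl power_increasing) auto
    also have "\<dots> \<le> d * d ^ (l - 1)" using large(2) by (intro mult_le_mono1)
    also have "\<dots> = d ^ l" using l by (simp flip: power_Suc)
    finally show False using kx(4) by (simp add: S_def)
  qed
  have Qk: "Q ^ (k - 2) = Q * Q ^ (k - 3)"
  proof -
    have "k - 2 = Suc (k - 3)" using kx(1) by simp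
    then show ?thesis by simp
  qed
  define f where "f q = (q ! (k - 2), last q)" for q :: "'a list"
  define R where "R = f ` S"
  have finR: "finite R" using finS by (simp add: R_def)
  have R_props: "E y z \<and> y \<noteq> x \<and> z \<noteq> x \<and> z \<in> last ` S" if "(y, z) \<in> R" for y z
  proof -
    obtain q where q: "q \<in> S" "y = q ! (k - 2)" "z = last q"
      using \<open>(y, z) \<in> R\<close> by (auto simp: R_def f_def)
    note g = S_good[OF q(1)]
    have z: "z = q ! (k - 1)" using q(3) g(3) kx(1) by (subst q(3), subst last_conv_nth) auto
    have x: "x = q ! 0" using g(3,5) kx(1) by (subst hd_conv_nth[symmetric]) auto
    have "E (q ! (k - 2)) (q ! Suc (k - 2))"
      using g(3,6) kx(1) by (intro successively_nth[of E]) auto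
    moreover have "Suc (k - 2) = k - 1" using kx(1) by simp
    ultimately have "E y z" using z q(2) by simp
    moreover have "q ! (k - 2) \<noteq> q ! 0" "q ! (k - 1) \<noteq> q ! 0"
      using nth_eq_iff_index_eq[OF g(4), of "k - 2" 0] nth_eq_iff_index_eq[OF g(4), of "k - 1" 0]
        g(3) kx(1) by auto
    ultimately show ?thesis using q z x by auto
  qed
  \<comment> \<open>With the last edge fixed, a path is determined by its first \<open>k - 1\<close>
    vertices. These form a proper subpath with fixed ends that are not rich.\<close>
  have S_le: "card S \<le> card R * Q ^ (k - 3)"
  proof -
    have "card {q \<in> S. f q = r} \<le> Q ^ (k - 3)" if "r \<in> R" for r
    proof -
      obtain q0 where q0: "q0 \<in> S" "r = f q0" using \<open>r \<in> R\<close> by (auto simp: R_def)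
      have but: "butlast q \<in> good Q (k - 1) x (q0 ! (k - 2)) \<and> card (good Q (k - 1) x (q0 ! (k - 2))) \<le> Q ^ (k - 3)"
        if q: "q \<in> S" "f q = r" for q
      proof -
        note g = S_good[OF q(1)]
        have ne: "butlast q \<noteq> []" using g(3) kx(1) by (cases q; cases "tl q") auto
        have "hd (butlast q) = hd q" using ne by (cases q; cases "tl q") auto
        then have eqs: "length (butlast q) = k - 1" "hd (butlast q) = x" "last (butlast q) = q0 ! (k - 2)"
          using g(3,5) kx(1) ne q(2) q0(2) last_butlast[of q]
          by (auto simp: f_def)
        show ?thesis
          using good_sublist[OF g(1) sublist_butlast] card_good_sublist[OF g(1) sublist_butlast ne] kx(1)
          unfolding eqs by (simp add: numeral_3_eq_3)
      qed
      have "inj_on butlast {q \<in> S. f q = r}"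
      proof (rule inj_onI)
        fix q q' assume qq: "q \<in> {q \<in> S. f q = r}" "q' \<in> {q \<in> S. f q = r}" "butlast q = butlast q'"
        then have "q \<in> S" "q' \<in> S" "f q = f q'" by auto
        then have "length q = k" "length q' = k" "last q = last q'" by (auto simp: f_def S_good(3))
        moreover have "q \<noteq> []" "q' \<noteq> []" using calculation kx(1) by auto
        moreover note qq(3)
        ultimately show "q = q'" by (metis append_butlast_last_id)
      qed
      then have "card {q \<in> S. f q = r} \<le> card (good Q (k - 1) x (q0 ! (k - 2)))"
        using but by (intro card_inj_on_le) auto
      then show ?thesis using but[OF q0(1)] q0(2) by simp
    qed
    then have "(\<Sum>r\<in>R. card {q \<in> S. f q = r}) \<le> card R * Q ^ (k - 3)"
      using sum_bounded_above[of R "\<lambda>r. card {q \<in> S. f q = r}" "Q ^ (k - 3)"] by simp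
    then show ?thesis using card_eq_sum_fibres[OF finS, of f] by (simp add: R_def)
  qed
  have Ran: "Range R = last ` S" by (force simp: R_def f_def)
  have "card (last ` S) * Q ^ (k - 2) \<le> card S"
  proof -
    have "Q ^ (k - 2) \<le> card {q \<in> S. last q = z}" if "z \<in> last ` S" for z
    proof -
      obtain q0 where q0: "q0 \<in> S" "last q0 = z" using \<open>z \<in> last ` S\<close> by auto
      have "good Q k x z \<subseteq> {q \<in> S. last q = z}"
        using S_good(2)[OF q0(1)] q0(2) by (auto simp: S_def rich_paths_def good_def)
      then have "card (good Q k x z) \<le> card {q \<in> S. last q = z}"
        using finS by (intro card_mono) auto
      then show ?thesis using S_good(2)[OF q0(1)] q0(2) by simp
    qed
    then show ?thesis
      using sum_bounded_below[of "last ` S" "Q ^ (k - 2)" "\<lambda>z. card {q \<in> S. last q = z}"]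
      by (simp add: card_eq_sum_fibres[OF finS, of last])
  qed
  then have "card (last ` S) * Q ^ (k - 2) \<le> card R * Q ^ (k - 3)"
    using S_le by (rule le_trans)
  then have "Q * card (Range R) * Q ^ (k - 3) \<le> card R * Q ^ (k - 3)"
    by (simp only: Qk Ran mult_ac)
  then have ran: "Q * card (Range R) \<le> card R" using Q0 by simp
  \<comment> \<open>Penultimate vertices are reached from \<open>x\<close> by walks of
    \<open>k - 2\<close> steps.\<close>
  have "card (Domain R) \<le> (K * d) ^ (k - 2)"
  proof -
    let ?A = "{p. length p = Suc 0 + (k - 2) \<and> successively E p \<and> take (Suc 0) p \<in> {[x]}}"
    have A: "finite ?A \<and> card ?A \<le> card {[x]} * (K * d) ^ (k - 2)"
      by (rule extend_right) (use deg_le in auto)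
    have "Domain R \<subseteq> last ` ?A"
    proof
      fix y assume "y \<in> Domain R"
      then obtain q where q: "q \<in> S" "y = q ! (k - 2)" by (auto simp: R_def f_def)
      note g = S_good[OF q(1)]
      have ne: "butlast q \<noteq> []" using g(3) kx(1) by (cases q; cases "tl q") auto
      have "last (butlast q) = y" using g(3) kx(1) q(2) last_butlast[of q] by simp
      moreover have "successively E (butlast q)"
        using g(6) ne by (metis append_butlast_last_id butlast.simps(1) successively_append_iff)
      moreover have "take (Suc 0) (butlast q) = [x]"
        using ne g(5) by (cases q; cases "tl q") auto
      ultimately have "butlast q \<in> ?A" "last (butlast q) = y" using g(3) kx(1) by auto
      then show "y \<in> last ` ?A" by blast
    qed
    then have "card (Domain R) \<le> card (last ` ?A)" using A by (intro card_mono) auto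
    also have "\<dots> \<le> card ?A" using A by (intro card_image_le) auto
    finally show ?thesis using A by simp
  qed
  then have "Q ^ (k - 2) * card (Domain R) \<le> card S"
    using S_large by (meson mult_le_mono2 le_trans)
  then have "Q ^ (k - 2) * card (Domain R) \<le> card R * Q ^ (k - 3)"
    using S_le by (rule le_trans)
  then have "Q * card (Domain R) * Q ^ (k - 3) \<le> card R * Q ^ (k - 3)"
    by (simp only: Qk mult_ac)
  then have dom: "Q * card (Domain R) \<le> card R" using Q0 by simp
  have "R \<noteq> {}"
    using kx(4) by (auto simp: R_def S_def[symmetric])
  moreover have "Q * (card (Domain R) + card (Range R)) \<le> 2 * card R"
    using dom ran by (simp add: distrib_left)
  ultimately have "\<exists>R'\<subseteq>R. R' \<noteq> {} \<and> (\<forall>y\<in>Domain R'. Q \<le> 2 * card (R' `` {y})) \<and>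
      (\<forall>z\<in>Range R'. Q \<le> 2 * card (R'\<inverse> `` {z}))"
    by (rule min_degree_subrelation[OF finR])
  then obtain R' where R': "R' \<subseteq> R" "R' \<noteq> {}"
    "\<forall>y\<in>Domain R'. Q \<le> 2 * card (R' `` {y})" "\<forall>z\<in>Range R'. Q \<le> 2 * card (R'\<inverse> `` {z})"
    by (elim exE conjE)
  have "\<exists>p. robust l (l * t) p x"
  proof (rule robust_spider[OF kx(1,2) t, where Z = "last ` S" and R = R' and Q = Q])
    show "Q ^ (k - 2) < card (good Q k x z)" if "z \<in> last ` S" for z
      using that S_good(2) by auto
    show "E y z \<and> y \<noteq> x \<and> z \<noteq> x \<and> z \<in> last ` S" if "(y, z) \<in> R'" for y z
      using that R' R_props by blast
  qed (use R' Q in auto)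
  with neg show False by blast
qed

end

section \<open>Embedding the theta graph\<close>

lemma (in graph_rel) contains_theta_graph:
  assumes l: "1 \<le> l" and t: "1 \<le> t" and "robust l (l * t) x y"
    and V: "V \<subseteq> verts G" and E: "\<And>u v. E u v \<Longrightarrow> {u, v} \<in> edges G"
  shows "contains_copy G (theta_graph l t)"
proof -
  obtain P where P: "\<And>i. i < t \<Longrightarrow> P i \<in> paths (Suc l)"
    "\<And>i. i < t \<Longrightarrow> hd (P i) = x" "\<And>i. i < t \<Longrightarrow> last (P i) = y"
    and disj: "\<And>i j. i < t \<Longrightarrow> j < t \<Longrightarrow> i \<noteq> j \<Longrightarrow> inner (P i) \<inter> inner (P j) = {}"
    using robust_disjoint_paths[OF assms(3) order_refl] by blast
  have len: "length (P i) = Suc l" "distinct (P i)" "successively E (P i)" "set (P i) \<subseteq> V" if "i < t" for i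
    using P(1)[OF that] by (auto simp: paths_def)
  have ends: "P i ! 0 = x" "P i ! l = y" if "i < t" for i
  proof -
    have "P i \<noteq> []" using len(1)[OF that] by auto
    then show "P i ! 0 = x" "P i ! l = y"
      using P(2,3)[OF that] len(1)[OF that] by (simp_all add: hd_conv_nth last_conv_nth)
  qed
  define f where "f v = (case v of Source \<Rightarrow> x | Sink \<Rightarrow> y | Inner i j \<Rightarrow> P i ! j)" for v
  have f_pos: "f (theta_pos l i j) = P i ! j" if "i < t" "j \<le> l" for i j
    using that ends by (auto simp: f_def theta_pos_def)
  have P_eq: "P i ! j = P i ! j' \<longleftrightarrow> j = j'" if "i < t" "j \<le> l" "j' \<le> l" for i j j'
    using that len by (intro nth_eq_iff_index_eq) auto
  have in_inner: "P i ! j \<in> inner (P i)" if "i < t" "0 < j" "j < l" for i j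
    using that len(1) by (auto simp: in_inner_conv_nth)
  have verts_theta: "verts (theta_graph l t) = {theta_pos l i j | i j. i < t \<and> j \<le> l}"
  proof -
    let ?A = "{theta_pos l i j | i j. i < t \<and> j \<le> l}"
    have "Source \<in> ?A"
      by (rule CollectI, intro exI[of _ 0]) (use t in \<open>simp add: theta_pos_def\<close>)
    moreover have "Sink \<in> ?A"
      by (rule CollectI, intro exI[of _ 0] exI[of _ l]) (use l t in \<open>simp add: theta_pos_def\<close>)
    ultimately show ?thesis
      unfolding theta_graph_def fst_conv by blast
  qed
  have "inj_on f (verts (theta_graph l t))"
  proof (rule inj_onI)
    fix a b assume "a \<in> verts (theta_graph l t)" "b \<in> verts (theta_graph l t)" and eq: "f a = f b"
    then obtain i j i' j' where a: "a = theta_pos l i j" "i < t" "j \<le> l"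
      and b: "b = theta_pos l i' j'" "i' < t" "j' \<le> l"
      unfolding verts_theta by blast
    have ij: "P i ! j = P i' ! j'" using eq a b by (simp add: f_pos)
    show "a = b"
    proof (cases "i = i'")
      case True
      then show ?thesis using ij a b P_eq[of i j j'] by simp
    next
      case False
      \<comment> \<open>Two different paths share only their ends, and there
        \<open>theta_pos\<close> does not depend on \<open>i\<close>.\<close>
      have "j = j' \<and> (j = 0 \<or> j = l)"
      proof (cases "j = 0 \<or> j = l")
        case True
        then have "P i ! j = P i' ! j" using ends a(2) b(2) by metis
        then have "j = j'" using ij P_eq[of i' j j'] a b by metis
        then show ?thesis using True by blast
      next
        case j: False
        show ?thesis
        proof (cases "j' = 0 \<or> j' = l")
          case True
          then have "P i' ! j' = P i ! j'" using ends a(2) b(2) by metis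
          then have "j = j'" using ij P_eq[of i j j'] a b by metis
          then show ?thesis using True j by blast
        next
          case False
          then have "P i ! j \<in> inner (P i)" "P i' ! j' \<in> inner (P i')"
            using in_inner[of i j] in_inner[of i' j'] a b j by auto
          then show ?thesis using disj[OF a(2) b(2) \<open>i \<noteq> i'\<close>] ij by auto
        qed
      qed
      then show ?thesis using a b by (auto simp: theta_pos_def)
    qed
  qed
  moreover have "f ` verts (theta_graph l t) \<subseteq> verts G"
  proof
    fix z assume "z \<in> f ` verts (theta_graph l t)"
    then obtain i j where "z = P i ! j" "i < t" "j \<le> l"
      unfolding verts_theta using f_pos by auto
    then have "z \<in> set (P i)" using len(1) by simp
    then show "z \<in> verts G" using len(4) V \<open>i < t\<close> by blast
  qed
  moreover have "f ` e \<in> edges G" if e_in: "e \<in> edges (theta_graph l t)" for e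
  proof -
    obtain i j where e: "e = {theta_pos l i j, theta_pos l i (Suc j)}" "i < t" "j < l"
      using e_in by (auto simp: theta_graph_def)
    then have "f ` e = {P i ! j, P i ! Suc j}" by (simp add: f_pos)
    moreover have "E (P i ! j) (P i ! Suc j)"
      using successively_nth[OF len(3)[OF e(2)]] len(1)[OF e(2)] e(3) by simp
    ultimately show ?thesis using E by simp
  qed
  ultimately show ?thesis unfolding contains_copy_def by blast
qed

section \<open>Almost regular subgraphs\<close>

locale two_uniform =
  fixes V :: "'a set" and F :: "'a set set"
  assumes finite_V: "finite V"
    and F: "\<And>a. a \<in> F \<Longrightarrow> a \<subseteq> V \<and> card a = 2"
begin

definition num_edges :: "'a set \<Rightarrow> nat" where
  "num_edges U = card {a \<in> F. a \<subseteq> U}"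

definition deg :: "'a set \<Rightarrow> 'a \<Rightarrow> nat" where
  "deg U v = card {a \<in> F. a \<subseteq> U \<and> v \<in> a}"

lemma finite_F: "finite F"
  by (rule finite_subset[of _ "Pow V"]) (use F finite_V in auto)

lemma finite_edges [simp]: "finite {a \<in> F. P a}"
  using finite_F by simp

lemma deg_mono: "U \<subseteq> U' \<Longrightarrow> deg U v \<le> deg U' v"
  unfolding deg_def by (rule card_mono) auto

lemma num_edges_empty [simp]: "num_edges {} = 0"
proof -
  have "{a \<in> F. a \<subseteq> {}} = {}" using F[of "{}"] by auto
  then show ?thesis by (simp only: num_edges_def card.empty)
qed

lemma sum_deg:
  assumes "U \<subseteq> V"
  shows "(\<Sum>v\<in>U. deg U v) = 2 * num_edges U"
proof -
  have fin: "finite U" using assms finite_V finite_subset by blast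
  have "(\<Sum>v\<in>U. deg U v) = (\<Sum>v\<in>U. \<Sum>a | a \<in> F \<and> a \<subseteq> U \<and> v \<in> a. 1)"
    by (simp add: deg_def)
  also have "\<dots> = (\<Sum>v\<in>U. \<Sum>a | a \<in> {a \<in> F. a \<subseteq> U} \<and> v \<in> a. 1)"
    by (simp add: conj_assoc)
  also have "\<dots> = (\<Sum>a\<in>{a \<in> F. a \<subseteq> U}. \<Sum>v | v \<in> U \<and> v \<in> a. 1)"
    by (rule sum.swap_restrict[OF fin]) simp
  also have "\<dots> = (\<Sum>a\<in>{a \<in> F. a \<subseteq> U}. 2)"
  proof (rule sum.cong[OF refl])
    fix a assume a: "a \<in> {a \<in> F. a \<subseteq> U}"
    then have "{v. v \<in> U \<and> v \<in> a} = a" by blast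
    then show "(\<Sum>v | v \<in> U \<and> v \<in> a. 1) = (2::nat)" using F a by simp
  qed
  finally show ?thesis by (simp add: num_edges_def)
qed

lemma num_edges_le_square: "U \<subseteq> V \<Longrightarrow> num_edges U \<le> card U ^ 2"
proof -
  assume "U \<subseteq> V"
  then have fin: "finite U" using finite_V finite_subset by blast
  have "num_edges U \<le> card {a. a \<subseteq> U \<and> card a = 2}"
    unfolding num_edges_def
  proof (rule card_mono)
    show "finite {a. a \<subseteq> U \<and> card a = 2}"
      by (rule finite_subset[of _ "Pow U"]) (auto simp: fin)
  qed (use F in auto)
  also have "\<dots> = card U choose 2" by (rule n_subsets[OF fin])
  also have "\<dots> \<le> card U ^ 2"
    using binomial_le_pow[of 2 "card U"] by (cases "2 \<le> card U") (simp_all add: binomial_eq_0)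
  finally show ?thesis .
qed

lemma num_edges_remove: "num_edges U = num_edges (U - {v}) + deg U v"
proof -
  have "{a \<in> F. a \<subseteq> U} = {a \<in> F. a \<subseteq> U - {v}} \<union> {a \<in> F. a \<subseteq> U \<and> v \<in> a}" by auto
  then show ?thesis
    unfolding num_edges_def deg_def by (subst card_Un_disjoint[symmetric]) auto
qed

text \<open>A smallest nonempty subset of density at least \<open>r\<close> works: deleting a vertex
  of degree below \<open>r\<close> would leave a strictly denser set, which cannot be empty because
  its density inequality is strict.\<close>

lemma exists_min_degree:
  assumes U: "U \<subseteq> V" "U \<noteq> {}" and "r * real (card U) \<le> real (num_edges U)"
  shows "\<exists>U'\<subseteq>U. U' \<noteq> {} \<and> (\<forall>v\<in>U'. r \<le> real (deg U' v))"
proof -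
  let ?P = "\<lambda>U'. U' \<subseteq> U \<and> U' \<noteq> {} \<and> r * real (card U') \<le> real (num_edges U')"
  have "?P U" using assms by simp
  then obtain U' where U': "?P U'" and min: "\<And>W. ?P W \<Longrightarrow> card U' \<le> card W"
    using ex_has_least_nat[of ?P U card] by blast
  have fin: "finite U'" using U U' finite_V by (meson finite_subset)
  have "r \<le> real (deg U' v)" if v: "v \<in> U'" for v
  proof (rule ccontr)
    assume neg: "\<not> ?thesis"
    have card: "card U' = Suc (card (U' - {v}))" 
      using card_Suc_Diff1[OF fin v] by simp
    have "r * real (card U') = r + r * real (card (U' - {v}))"
      by (simp add: card distrib_left)
    then have *: "r * real (card (U' - {v})) < real (num_edges (U' - {v}))"
      using U' neg num_edges_remove[of U' v] by linarith
    moreover have "U' - {v} \<noteq> {}"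
    proof
      assume "U' - {v} = {}"
      with * show False by (simp only: card.empty num_edges_empty)
    qed
    ultimately have "?P (U' - {v})" using U' by auto
    from min[OF this] show False using card by simp
  qed
  then show ?thesis using U' by blast
qed

end

lemma exists_max_on:
  fixes h :: "'a \<Rightarrow> real"
  assumes "finite S" "S \<noteq> {}"
  shows "\<exists>x\<in>S. \<forall>y\<in>S. h y \<le> h x"
proof -
  have "Max (h ` S) \<in> h ` S" using assms by (intro Max_in) auto
  then obtain x where "x \<in> S" "h x = Max (h ` S)" by auto
  moreover have "h y \<le> Max (h ` S)" if "y \<in> S" for y using assms that by (intro Max_ge) auto
  ultimately show ?thesis by (intro bexI[of _ x] ballI) simp_all
qed

text \<open>Number the vertices and colour by residues modulo \<open>A\<close>; within a colour
  class the quotients are distinct.\<close>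

lemma balanced_colouring:
  assumes "finite U" "0 < A"
  shows "\<exists>h. (\<forall>v. h v < A) \<and> (\<forall>j. card {v \<in> U. h v = j} \<le> card U div A + 1)"
proof -
  obtain g where g: "bij_betw g U {0..<card U}"
    using ex_bij_betw_finite_nat[OF assms(1)] by blast
  have "card {v \<in> U. g v mod A = j} \<le> card U div A + 1" for j
  proof -
    have "inj_on (\<lambda>v. g v div A) {v \<in> U. g v mod A = j}"
    proof (rule inj_onI)
      fix u v assume uv: "u \<in> {v \<in> U. g v mod A = j}" "v \<in> {v \<in> U. g v mod A = j}" "g u div A = g v div A"
      then have "g u = g v" by (metis (mono_tags, lifting) div_mult_mod_eq mem_Collect_eq)
      then show "u = v" using uv g by (auto simp: bij_betw_def inj_on_def)
    qed
    moreover have "(\<lambda>v. g v div A) ` {v \<in> U. g v mod A = j} \<subseteq> {..card U div A}"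
    proof (clarify)
      fix v assume "v \<in> U"
      then have "g v < card U" using g by (auto simp: bij_betw_def)
      then show "g v div A \<le> card U div A" by (simp add: div_le_mono)
    qed
    ultimately have "card {v \<in> U. g v mod A = j} \<le> card {..card U div A}"
      by (rule card_inj_on_le) simp
    then show ?thesis by simp
  qed
  then show ?thesis using assms(2) by (intro exI[of _ "\<lambda>v. g v mod A"]) auto
qed

context two_uniform
begin

text \<open>An edge meeting \<open>B\<close> lies in the union of \<open>B\<close> with the colour
  class of its other end, so the \<open>A\<close> unions cover all such edges.\<close>

lemma card_edges_meeting_le:
  assumes "U \<subseteq> V" "B \<subseteq> U" "\<And>v. v \<in> U \<Longrightarrow> h v < A"
    and "\<And>j. j < A \<Longrightarrow> real (num_edges (B \<union> {v \<in> U. h v = j})) \<le> c"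
  shows "real (num_edges U) - real (num_edges (U - B)) \<le> real A * c"
proof -
  let ?T = "\<Union>j\<in>{..<A}. {a \<in> F. a \<subseteq> B \<union> {v \<in> U. h v = j}}"
  have "{a \<in> F. a \<subseteq> U} \<subseteq> {a \<in> F. a \<subseteq> U - B} \<union> ?T"
  proof
    fix a assume a: "a \<in> {a \<in> F. a \<subseteq> U}"
    show "a \<in> {a \<in> F. a \<subseteq> U - B} \<union> ?T"
    proof (cases "a \<inter> B = {}")
      case False
      then obtain u where u: "u \<in> a" "u \<in> B" by blast
      have "card a = 2" using a F by blast
      then obtain v where v: "a = {u, v}" using u(1) by (auto simp: card_2_iff)
      then have "v \<in> U" using a by blast
      then have "h v < A" "a \<subseteq> B \<union> {v' \<in> U. h v' = h v}" using assms(3) v u by auto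
      then show ?thesis using a by blast
    qed (use a in auto)
  qed
  then have "num_edges U \<le> card ({a \<in> F. a \<subseteq> U - B} \<union> ?T)"
    unfolding num_edges_def by (rule card_mono[rotated]) auto
  also have "\<dots> \<le> num_edges (U - B) + card ?T"
    unfolding num_edges_def by (rule card_Un_le)
  also have "card ?T \<le> (\<Sum>j<A. num_edges (B \<union> {v \<in> U. h v = j}))"
    unfolding num_edges_def by (rule card_UN_le) simp
  finally have "real (num_edges U) \<le> real (num_edges (U - B)) + (\<Sum>j<A. real (num_edges (B \<union> {v \<in> U. h v = j})))"
    by (simp flip: of_nat_sum of_nat_add)
  moreover have "(\<Sum>j<A. real (num_edges (B \<union> {v \<in> U. h v = j}))) \<le> real A * c"
    using sum_bounded_above[of "{..<A}" "\<lambda>j. real (num_edges (B \<union> {v \<in> U. h v = j}))" c] assms(4) by simp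
  ultimately show ?thesis by linarith
qed

lemma card_high_degree_le:
  assumes "U \<subseteq> V" "0 < r"
  shows "real (card {v \<in> U. r < real (deg U v)}) * r \<le> 2 * real (num_edges U)"
proof -
  have fin: "finite U" using assms finite_V finite_subset by blast
  have "real (card {v \<in> U. r < real (deg U v)}) * r \<le> (\<Sum>v | v \<in> U \<and> r < real (deg U v). real (deg U v))"
    using sum_bounded_below[of "{v \<in> U. r < real (deg U v)}" r "\<lambda>v. real (deg U v)"] by auto
  also have "\<dots> \<le> (\<Sum>v\<in>U. real (deg U v))"
    by (rule sum_mono2) (use fin in auto)
  also have "\<dots> = 2 * real (num_edges U)"
    using sum_deg[OF assms(1)] by (metis of_nat_mult of_nat_numeral of_nat_sum)
  finally show ?thesis .
qed

text \<open>Take \<open>U\<close> maximising \<open>e(U) / |U| ^ \<alpha>\<close>. If \<open>B\<close> is the set of the at most \<open>2 |U| / A\<close> vertices of large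
  degree, split \<open>U\<close> into \<open>A\<close> equal blocks: maximality bounds the edges inside each union of \<open>B\<close> and a block,
  and together these unions contain at most half of the edges of \<open>U\<close>. The exponent \<open>\<alpha> = 1 + 1/(2l)\<close>,
  rather than \<open>1 + 1/l\<close>, forces the average degree in \<open>U\<close> to tend to infinity with \<open>n\<close>.\<close>

lemma almost_regular_subset:
  fixes A l n :: nat and c :: real
  defines "n \<equiv> card V" and "A \<equiv> 32 ^ (2 * l)"
  assumes l: "1 \<le> l"
    and many: "c * real n powr (1 + 1 / real l) \<le> real (card F)"
    and large: "real A \<le> c * real n powr (1 / (2 * real l))"
  shows "\<exists>U\<subseteq>V. \<exists>w. U \<noteq> {} \<and> c * real n powr (1 / (2 * real l)) \<le> w \<and>
    c * real (card U) powr (1 / real l) \<le> w \<and>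
    (\<forall>v\<in>U. w / 2 \<le> real (deg U v) \<and> real (deg U v) \<le> real A * w)"
proof -
  define s where "s = 1 / (2 * real l)"
  define \<alpha> where "\<alpha> = 1 + s"
  have s: "0 < s" "s \<le> 1" "1 / real l = 2 * s" using l by (auto simp: s_def field_simps)
  have A0: "0 < A" by (simp add: A_def)
  have "0 < c * real n powr s" using large A0 by (simp add: s_def)
  then have c0: "0 < c" and n0: "0 < n"
    by (auto simp: zero_less_mult_iff)
  have V_ne: "V \<noteq> {}" using n0 by (auto simp: n_def)
  let ?h = "\<lambda>U. real (num_edges U) / real (card U) powr \<alpha>"
  have "\<exists>U\<in>Pow V - {{}}. \<forall>S\<in>Pow V - {{}}. ?h S \<le> ?h U"
    by (rule exists_max_on) (use finite_V V_ne in auto)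
  then obtain U where U: "U \<subseteq> V" "U \<noteq> {}" and max: "\<And>S. S \<subseteq> V \<Longrightarrow> S \<noteq> {} \<Longrightarrow> ?h S \<le> ?h U"
    by blast
  have finU: "finite U" using U finite_V finite_subset by blast
  \<comment> \<open>\<open>q\<close> is the maximal ratio and \<open>w\<close> is half the average
    degree inside \<open>U\<close>.\<close>
  define m e q w where "m = card U" and "e = num_edges U" and "q = ?h U" and "w = real e / real m"
  have m0: "0 < m" using U finU by (simp add: m_def card_gt_0_iff)
  have m_le: "m \<le> n" unfolding m_def n_def by (rule card_mono[OF finite_V U(1)])
  have num_le: "real (num_edges S) \<le> q * real (card S) powr \<alpha>" if "S \<subseteq> V" for S
  proof (cases "S = {}")
    case False
    then have "0 < card S" using that finite_V finite_subset by (auto simp: card_gt_0_iff)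
    then have "0 < real (card S) powr \<alpha>" by simp
    then show ?thesis using max[OF that False] by (simp add: q_def pos_divide_le_eq)
  qed simp
  have w_q: "w = q * real m powr s"
    using m0 by (simp add: w_def q_def \<alpha>_def powr_add e_def m_def)
  \<comment> \<open>Compare \<open>U\<close> with the whole vertex set; the exponents
    \<open>1 + 2 * s\<close> and \<open>\<alpha> = 1 + s\<close> differ by \<open>s\<close>.\<close>
  have q_ge: "c * real n powr s \<le> q"
  proof -
    have "num_edges V = card F" unfolding num_edges_def using F by (metis (no_types, lifting) Collect_cong Collect_mem_eq)
    then have "real (card F) \<le> q * real n powr \<alpha>" using num_le[of V] by (simp add: n_def)
    moreover have "1 + 1 / real l = \<alpha> + s" using s by (simp add: \<alpha>_def)
    ultimately have "c * real n powr (\<alpha> + s) \<le> q * real n powr \<alpha>" using many by simp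
    then have "(c * real n powr s) * real n powr \<alpha> \<le> q * real n powr \<alpha>"
      by (simp add: powr_add mult_ac)
    then show ?thesis using n0 by simp
  qed
  have ms: "1 \<le> real m powr s" using m0 s by (intro ge_one_powr_ge_zero) auto
  have w1: "c * real n powr s \<le> w"
  proof -
    have "c * real n powr s * 1 \<le> q * real m powr s"
      using q_ge ms by (intro mult_mono) (auto simp: q_def)
    then show ?thesis by (simp add: w_q)
  qed
  have w0: "0 < w" using w1 c0 n0 by (smt (verit) mult_pos_pos of_nat_0_less_iff powr_gt_zero)
  \<comment> \<open>Stated for every \<open>k \<le> m\<close> because the final set is a subset of
    \<open>U\<close>.\<close>
  have w2: "c * real k powr (1 / real l) \<le> w" if "k \<le> m" for k :: nat
  proof -
    have "c * real k powr (2 * s) = c * real k powr s * real k powr s"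
      by (simp add: powr_add[symmetric] mult.assoc)
    also have "\<dots> \<le> c * real n powr s * real m powr s"
      using that m_le c0 s by (intro mult_mono powr_mono2) auto
    also have "\<dots> \<le> q * real m powr s" using q_ge by (intro mult_right_mono) auto
    finally show ?thesis by (simp add: w_q s)
  qed
  have e_w: "real e = w * real m" using m0 by (simp add: w_def)
  \<comment> \<open>This yields \<open>w \<le> m\<close> and so \<open>A \<le> m\<close>, which
    absorbs the rounding in the block sizes.\<close>
  have "real e \<le> real m * real m"
    using num_edges_le_square[OF U(1)] by (simp add: e_def m_def power2_eq_square flip: of_nat_mult)
  then have "w \<le> real m" using m0 by (simp add: w_def pos_divide_le_eq)
  then have A_m: "real A \<le> real m" using large w1 by (simp add: s_def)
  define B where "B = {v \<in> U. real A * w < real (deg U v)}"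
  have "real (card B) * (real A * w) \<le> 2 * (w * real m)"
    using card_high_degree_le[OF U(1), of "real A * w"] A0 w0 by (simp add: B_def e_w[symmetric] e_def)
  then have "w * (real (card B) * real A) \<le> w * (2 * real m)" by (simp add: mult_ac)
  then have B_card: "real (card B) \<le> 2 * real m / real A"
    using w0 A0 by (simp add: pos_le_divide_eq)
  obtain g where g: "\<And>v. g v < A" "\<And>j. card {v \<in> U. g v = j} \<le> m div A + 1"
    using balanced_colouring[OF finU A0] unfolding m_def by blast
  have block: "real (num_edges (B \<union> {v \<in> U. g v = j})) \<le> q * (4 * real m / real A) powr \<alpha>" for j
  proof -
    have "real (card {v \<in> U. g v = j}) \<le> real (m div A) + 1"
      using g(2)[of j] by linarith
    also have "\<dots> \<le> real m / real A + real m / real A"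
      using A_m A0 by (intro add_mono) (auto simp: of_nat_div_le_of_nat pos_le_divide_eq)
    finally have "real (card (B \<union> {v \<in> U. g v = j})) \<le> 4 * real m / real A"
      using B_card card_Un_le[of B "{v \<in> U. g v = j}"] by linarith
    then have "real (card (B \<union> {v \<in> U. g v = j})) powr \<alpha> \<le> (4 * real m / real A) powr \<alpha>"
      using s by (intro powr_mono2) (auto simp: \<alpha>_def)
    then have "q * real (card (B \<union> {v \<in> U. g v = j})) powr \<alpha> \<le> q * (4 * real m / real A) powr \<alpha>"
      by (intro mult_left_mono) (auto simp: q_def)
    moreover have "B \<union> {v \<in> U. g v = j} \<subseteq> V" using U by (auto simp: B_def)
    ultimately show ?thesis using num_le by (meson order_trans)
  qed
  \<comment> \<open>The \<open>A\<close> unions have at most \<open>4 * m / A\<close> vertices each,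
    so the loss is at most \<open>e * 4 powr \<alpha> / A powr s\<close>. The choice of
    \<open>A\<close> gives \<open>A powr s = 32\<close>, and
    \<open>4 powr \<alpha> \<le> 16\<close>.\<close>
  have B_half: "real e - real (num_edges (U - B)) \<le> real e / 2"
  proof -
    have "real e - real (num_edges (U - B)) \<le> real A * (q * (4 * real m / real A) powr \<alpha>)"
      unfolding e_def by (rule card_edges_meeting_le[OF U(1), of B g]) (use g block in \<open>auto simp: B_def\<close>)
    also have "\<dots> = real e * (4 powr \<alpha> * (real A / real A powr \<alpha>))"
      using m0 A0 by (simp add: powr_divide powr_mult q_def e_def m_def)
    also have "\<dots> \<le> real e * (16 * (1 / 32))"
    proof (intro mult_left_mono mult_mono)
      have "4 powr \<alpha> \<le> 4 powr (2::real)" using s by (intro powr_mono) (auto simp: \<alpha>_def)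
      then show "4 powr \<alpha> \<le> 16" by simp
      have "real A = 32 powr (2 * real l)" by (simp add: A_def flip: powr_realpow)
      then have "real A powr s = 32" using l by (simp add: powr_powr s_def)
      then show "real A / real A powr \<alpha> \<le> 1 / 32" using A0 by (simp add: \<alpha>_def powr_add)
    qed auto
    finally show ?thesis by simp
  qed
  have "w / 2 * real (card (U - B)) \<le> real (num_edges (U - B))"
  proof -
    have "card (U - B) \<le> m" unfolding m_def by (rule card_mono[OF finU]) auto
    then have "w / 2 * real (card (U - B)) \<le> w / 2 * real m" using w0 by (intro mult_left_mono) auto
    also have "\<dots> = real e / 2" by (simp add: e_w)
    finally show ?thesis using B_half by linarith
  qed
  moreover have "U - B \<noteq> {}"
  proof
    assume "U - B = {}"
    then have "num_edges (U - B) = 0" by (simp only: num_edges_empty)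
    then have "real e \<le> 0" using B_half by simp
    then show False using e_w w0 m0 by (simp add: mult_le_0_iff)
  qed
  moreover have "U - B \<subseteq> V" using U by blast
  ultimately obtain U' where U': "U' \<subseteq> U - B" "U' \<noteq> {}" "\<And>v. v \<in> U' \<Longrightarrow> w / 2 \<le> real (deg U' v)"
    using exists_min_degree by metis
  have "real (deg U' v) \<le> real A * w" if "v \<in> U'" for v
  proof -
    have "v \<in> U" "v \<notin> B" using that U' by auto
    then have "real (deg U v) \<le> real A * w" by (auto simp: B_def)
    moreover have "deg U' v \<le> deg U v" by (rule deg_mono) (use U' in auto)
    ultimately show ?thesis by linarith
  qed
  moreover have "c * real (card U') powr (1 / real l) \<le> w"
    unfolding m_def by (rule w2) (use U' finU in \<open>auto simp: m_def intro: card_mono\<close>)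
  moreover have "c * real n powr (1 / (2 * real l)) \<le> w" using w1 by (simp add: s_def)
  ultimately show ?thesis using U' U by (intro exI[of _ U'] conjI exI[of _ w]) auto
qed

end

section \<open>The bound\<close>

text \<open>The bound on \<open>n\<close> gives \<open>X \<le> w\<close>. The summands of
  \<open>X\<close> serve, in order, the second part of \<open>large\<close> in
  \<open>exists_robust\<close>, the inequality \<open>d + l \<le> w / 2\<close>, the rounding in
  \<open>d\<close>, and the hypothesis \<open>large\<close> of
  \<open>almost_regular_subset\<close>.\<close>

lemma few_edges_if_no_theta:
  fixes G :: "'a graph" and l t :: nat
  defines "n \<equiv> card (verts G)"
    and "X \<equiv> 16 * l ^ 2 * (8 * 32 ^ (2 * l)) ^ l * (3 * l ^ 2 * t) ^ l + 4 * l + 8 + 32 ^ (2 * l)"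
  assumes G: "simple_graph G" and free: "\<not> contains_copy G (theta_graph l t)"
    and l: "2 \<le> l" and t: "1 \<le> t" and n: "X ^ (2 * l) \<le> n"
  shows "real (card (edges G)) \<le> 48 * real l ^ 2 * real t powr (1 - 1 / real l) * real n powr (1 + 1 / real l)"
proof (rule ccontr)
  assume neg: "\<not> ?thesis"
  interpret two_uniform "verts G" "edges G"
    using G by unfold_locales (auto simp: simple_graph_def)
  define c where "c = 48 * real l ^ 2 * real t powr (1 - 1 / real l)"
  define A :: nat where "A = 32 ^ (2 * l)"
  define K Q where "K = 8 * A" and "Q = 3 * l ^ 2 * t"
  have X_eq: "X = 16 * l ^ 2 * K ^ l * Q ^ l + 4 * l + 8 + A"
    by (simp add: X_def K_def Q_def A_def)
  have X0: "0 < X" by (simp add: X_def)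
  have c1: "1 \<le> c"
  proof -
    have "1 \<le> real t powr (1 - 1 / real l)" using t l by (intro ge_one_powr_ge_zero) auto
    moreover have "1 \<le> 48 * real l ^ 2"
      using l one_le_power[of "real l" 2] by linarith
    ultimately show ?thesis unfolding c_def by (metis mult_1 mult_mono' zero_le_one)
  qed
  have n_ge: "real X \<le> real n powr (1 / (2 * real l))"
  proof -
    have "real X = (real X ^ (2 * l)) powr (1 / (2 * real l))"
      using X0 l by (simp add: powr_powr flip: powr_realpow)
    also have "\<dots> \<le> real n powr (1 / (2 * real l))"
      using n by (intro powr_mono2) (auto simp flip: of_nat_power)
    finally show ?thesis .
  qed
  then have cn_ge: "real X \<le> c * real n powr (1 / (2 * real l))"
    using c1 mult_mono[of 1 c "real X" "real n powr (1 / (2 * real l))"] by simp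
  have "\<exists>U\<subseteq>verts G. \<exists>w. U \<noteq> {} \<and> c * real n powr (1 / (2 * real l)) \<le> w \<and>
    c * real (card U) powr (1 / real l) \<le> w \<and>
    (\<forall>v\<in>U. w / 2 \<le> real (deg U v) \<and> real (deg U v) \<le> real (32 ^ (2 * l)) * w)"
    unfolding n_def
  proof (rule almost_regular_subset)
    show "1 \<le> l" using l by simp
    show "c * real (card (verts G)) powr (1 + 1 / real l) \<le> real (card (edges G))"
      using neg by (simp add: c_def n_def)
    show "real (32 ^ (2 * l)) \<le> c * real (card (verts G)) powr (1 / (2 * real l))"
    proof -
      have "32 ^ (2 * l) \<le> X" by (simp add: X_eq A_def)
      then have "real (32 ^ (2 * l)) \<le> real X" by (simp only: of_nat_le_iff)
      also note cn_ge
      finally show ?thesis by (simp only: n_def)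
    qed
  qed
  then obtain U w where U: "U \<subseteq> verts G" "U \<noteq> {}" and w_n: "c * real n powr (1 / (2 * real l)) \<le> w"
    and w_U: "c * real (card U) powr (1 / real l) \<le> w"
    and degs: "\<And>v. v \<in> U \<Longrightarrow> w / 2 \<le> real (deg U v)" "\<And>v. v \<in> U \<Longrightarrow> real (deg U v) \<le> real A * w"
    unfolding A_def by blast
  have w_ge: "real k \<le> w" if "k \<le> X" for k using that cn_ge w_n by linarith
  \<comment> \<open>A quarter of \<open>w\<close> leaves room for \<open>l\<close> below the minimum
    degree \<open>w / 2\<close>; after rounding down, \<open>d\<close> is still at least
    \<open>w / 8\<close>, whence the 8 in \<open>K\<close>.\<close>
  define d where "d = nat \<lfloor>w / 4\<rfloor>"
  have d: "w / 8 \<le> real d" "real d \<le> w / 4"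
  proof -
    have "8 \<le> w" using w_ge[of 8] by (simp add: X_eq)
    then show "w / 8 \<le> real d" "real d \<le> w / 4" unfolding d_def by linarith+
  qed
  let ?E = "\<lambda>u v. {u, v} \<in> edges G \<and> u \<in> U \<and> v \<in> U"
  have finU: "finite U" using U finite_V finite_subset by blast
  interpret graph_rel U ?E
  proof
    show "\<not> ?E u u" for u using F[of "{u, u}"] by auto
  qed (use finU in \<open>auto simp: insert_commute\<close>)
  have nbrs: "card {u. ?E v u} = deg U v" if "v \<in> U" for v
  proof -
    have "bij_betw (\<lambda>u. {v, u}) {u. ?E v u} {a \<in> edges G. a \<subseteq> U \<and> v \<in> a}"
      unfolding bij_betw_def
    proof
      show "inj_on (\<lambda>u. {v, u}) {u. ?E v u}" by (auto simp: inj_on_def doubleton_eq_iff)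
      show "(\<lambda>u. {v, u}) ` {u. ?E v u} = {a \<in> edges G. a \<subseteq> U \<and> v \<in> a}"
      proof (intro equalityI subsetI)
        fix a assume a: "a \<in> {a \<in> edges G. a \<subseteq> U \<and> v \<in> a}"
        then have "card a = 2" using F by blast
        then obtain u where "a = {v, u}" using a by (auto simp: card_2_iff)
        then show "a \<in> (\<lambda>u. {v, u}) ` {u. ?E v u}" using a by auto
      qed (use that in auto)
    qed
    then show ?thesis unfolding deg_def by (rule bij_betw_same_card)
  qed
  have "\<exists>x y. robust l (l * t) x y"
  proof (rule exists_robust[where d = d and K = K and Q = Q])
    show "d + l \<le> card {u. ?E v u}" if "v \<in> U" for v
    proof -
      have "4 * real l \<le> w" using w_ge[of "4 * l"] by (simp add: X_eq)
      then have "real (d + l) \<le> w / 2" using d by simp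
      also have "\<dots> \<le> real (deg U v)" by (rule degs(1)[OF that])
      finally show ?thesis by (simp add: nbrs[OF that])
    qed
    show "card {u. ?E v u} \<le> K * d" for v
    proof (cases "v \<in> U")
      case True
      have "real (deg U v) \<le> real A * w" by (rule degs(2)[OF True])
      also have "\<dots> \<le> real A * (8 * real d)" using d by (intro mult_left_mono) auto
      also have "\<dots> = real (K * d)" by (simp add: K_def)
      finally show ?thesis using nbrs[OF True] by linarith
    qed simp
    \<comment> \<open>This fixes the constant 48: \<open>(c / 8) ^ l\<close> equals
      \<open>(6 * l ^ 2) ^ l * t ^ (l - 1)\<close> and so dominates \<open>2 * Q ^ (l - 1)\<close>,
      while \<open>w_U\<close> gives \<open>c ^ l * card U \<le> w ^ l\<close>.\<close>
    show "2 * card U * Q ^ (l - 1) \<le> d ^ l"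
    proof -
      have cU: "c ^ l * real (card U) \<le> w ^ l"
      proof -
        have "0 < card U" using U finU by (simp add: card_gt_0_iff)
        then have "(real (card U) powr (1 / real l)) ^ l = real (card U)"
          using l by (simp add: powr_powr flip: powr_realpow)
        then have "c ^ l * real (card U) = (c * real (card U) powr (1 / real l)) ^ l"
          by (simp add: power_mult_distrib)
        also have "\<dots> \<le> w ^ l" using w_U c1 by (intro power_mono) auto
        finally show ?thesis .
      qed
      have "(real t powr (1 - 1 / real l)) ^ l = real t ^ (l - 1)"
      proof -
        have "(real t powr (1 - 1 / real l)) ^ l = real t powr ((1 - 1 / real l) * real l)"
          using t by (simp add: powr_powr flip: powr_realpow)
        also have "(1 - 1 / real l) * real l = real (l - 1)" using l by (simp add: field_simps of_nat_diff)
        finally show ?thesis using t by (simp add: powr_realpow)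
      qed
      moreover have "c / 8 = (6 * real l ^ 2) * real t powr (1 - 1 / real l)"
        by (simp add: c_def)
      ultimately have c8: "(c / 8) ^ l = (6 * real l ^ 2) ^ l * real t ^ (l - 1)"
        by (simp only: power_mult_distrib)
      have "2 * (3 * real l ^ 2) ^ (l - 1) \<le> 6 * real l ^ 2 * (6 * real l ^ 2) ^ (l - 1)"
      proof (intro mult_mono power_mono)
        show "2 \<le> 6 * real l ^ 2" using l one_le_power[of "real l" 2] by linarith
      qed auto
      also have "\<dots> = (6 * real l ^ 2) ^ l"
        by (subst mult.commute, rule power_minus_mult) (use l in simp)
      finally have "2 * (3 * real l ^ 2) ^ (l - 1) * real t ^ (l - 1) \<le> (c / 8) ^ l"
        unfolding c8 by (rule mult_right_mono) simp
      moreover have "real Q = (3 * real l ^ 2) * real t"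
        by (simp add: Q_def)
      ultimately have "2 * real Q ^ (l - 1) \<le> (c / 8) ^ l"
        by (simp only: power_mult_distrib mult.assoc)
      then have "2 * real Q ^ (l - 1) * real (card U) \<le> (c / 8) ^ l * real (card U)"
        by (rule mult_right_mono) simp
      also have "\<dots> \<le> (w / 8) ^ l" using cU by (simp add: power_divide divide_right_mono)
      also have "\<dots> \<le> real d ^ l" using d w_ge[of 0] by (intro power_mono) auto
      finally have "real (2 * card U * Q ^ (l - 1)) \<le> real (d ^ l)" by (simp add: mult_ac)
      then show ?thesis by linarith
    qed
    show "2 * l ^ 2 * K ^ l * Q ^ l \<le> d"
    proof -
      have "8 * (2 * l ^ 2 * K ^ l * Q ^ l) \<le> X" by (simp add: X_eq)
      then have "real (8 * (2 * l ^ 2 * K ^ l * Q ^ l)) \<le> w" by (rule w_ge)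
      then have "real (2 * l ^ 2 * K ^ l * Q ^ l) \<le> real d" using d by linarith
      then show ?thesis by linarith
    qed
  qed (use U l t in \<open>auto simp: K_def A_def Q_def\<close>)
  then obtain x y where "robust l (l * t) x y" by blast
  then have "contains_copy G (theta_graph l t)"
    by (rule contains_theta_graph[rotated 2]) (use l t U in auto)
  with free show False by blast
qed

theorem theorem1:
  "\<forall>l::nat. l \<ge> 2 \<longrightarrow> (\<exists>C::real. C > 0 \<and> (\<forall>t::nat. t \<ge> 1 \<longrightarrow> (\<exists>n0::nat. \<forall>n::nat. n \<ge> n0 \<longrightarrow>
     real (ex n (theta_graph l t))
       \<le> C * real t powr (1 - 1 / real l) * real n powr (1 + 1 / real l))))"
proof (intro allI impI)
  fix l :: nat assume l: "2 \<le> l"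
  show "\<exists>C::real. C > 0 \<and> (\<forall>t::nat. t \<ge> 1 \<longrightarrow> (\<exists>n0::nat. \<forall>n::nat. n \<ge> n0 \<longrightarrow>
     real (ex n (theta_graph l t))
       \<le> C * real t powr (1 - 1 / real l) * real n powr (1 + 1 / real l)))"
  proof (rule exI[of _ "48 * real l ^ 2"], intro conjI allI impI)
    show "0 < 48 * real l ^ 2" using l by simp
    fix t :: nat assume t: "1 \<le> t"
    show "\<exists>n0::nat. \<forall>n::nat. n \<ge> n0 \<longrightarrow> real (ex n (theta_graph l t))
       \<le> 48 * real l ^ 2 * real t powr (1 - 1 / real l) * real n powr (1 + 1 / real l)"
    proof (intro exI allI impI)
      fix n :: nat
      \<comment> \<open>The witness \<open>n0\<close>, left open by \<open>exI\<close>, is fixed by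
        this assumption.\<close>
      assume n: "(16 * l ^ 2 * (8 * 32 ^ (2 * l)) ^ l * (3 * l ^ 2 * t) ^ l + 4 * l + 8 + 32 ^ (2 * l)) ^ (2 * l) \<le> n"
      let ?M = "{card (edges G) | G :: nat graph.
        simple_graph G \<and> card (verts G) = n \<and> \<not> contains_copy G (theta_graph l t)}"
      have "\<not> contains_copy ({..<n}, {}) (theta_graph l t)"
      proof -
        have "{theta_pos l 0 0, theta_pos l 0 (Suc 0)} \<in> edges (theta_graph l t)"
          using l t by (fastforce simp: theta_graph_def)
        then show ?thesis by (auto simp: contains_copy_def)
      qed
      then have "card (edges ({..<n} :: nat set, {})) \<in> ?M"
        by (intro CollectI exI[of _ "({..<n}, {})"]) (simp add: simple_graph_def)
      then have "?M \<noteq> {}" by blast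
      \<comment> \<open>A crude bound for finiteness; with nonemptiness it ensures that the maximum
        is attained by some graph.\<close>
      moreover have "?M \<subseteq> {..2 ^ n}"
      proof
        fix k assume "k \<in> ?M"
        then obtain G :: "nat graph" where G: "k = card (edges G)" "simple_graph G" "card (verts G) = n"
          by blast
        have "finite (verts G)" "edges G \<subseteq> Pow (verts G)" using G by (auto simp: simple_graph_def)
        then have "card (edges G) \<le> card (Pow (verts G))" by (intro card_mono) auto
        then show "k \<in> {..2 ^ n}" using G \<open>finite (verts G)\<close> by (simp add: card_Pow)
      qed
      then have "finite ?M" by (rule finite_subset) simp
      ultimately have "ex n (theta_graph l t) \<in> ?M" unfolding ex_def by (intro Max_in)
      then obtain G :: "nat graph" where G: "ex n (theta_graph l t) = card (edges G)" "simple_graph G"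
        "card (verts G) = n" "\<not> contains_copy G (theta_graph l t)" by blast
      show "real (ex n (theta_graph l t))
         \<le> 48 * real l ^ 2 * real t powr (1 - 1 / real l) * real n powr (1 + 1 / real l)"
        using few_edges_if_no_theta[OF G(2,4) l t] n unfolding G(1,3) by blast
    qed
  qed
qed

end
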